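(* Let $L$ be a positive definite even lattice that is generated (as an abelian group) by screeners of $L$. Then $L$ is an orthogonal direct sum of lattices of the form $\sqrt{p}\,K$ with $p$ a positive integer and $K$ a simply laced root lattice. Furthermore, the full sets of screeners of the simply laced root lattices occurring as such components are as follows. (1) For the root lattice $A_n$ with $n>3$, and for $E_n$ with $n=6,7,8$, the set of screeners is exactly the set of roots. (2) For $A_2$ and $A_3$ there are exactly $6$ screeners that are not roots; together with the roots they form a root system of type $G_2$ and $C_3$, respectively. (3) For $D_4$ there are exactly $24$ screeners that are not roots, and together with the roots they form a root system of type $F_4$. For $n>4$, $D_n$ has exactly $2n$ screeners that are not roots, and together with the roots they form a root system of type $C_n$. (4) For $n\ge 2$, the orthogonal direct sum of $n$ copies of $A_1$ has as its set of screeners the roots of a root system of type $B_n$ (dual to $C_n$).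
   Context: A positive definite integral lattice $L$ is a finitely generated free abelian group with a $\mathbb Z$-valued positive definite symmetric bilinear form $\langle\cdot,\cdot\rangle$; it is even if $\langle\alpha,\alpha\rangle\in 2\mathbb Z$ for all $\alpha\in L$. Put $L^{(0)}=\{\alpha\in L:\langle\alpha,\alpha\rangle\in2\mathbb Z\}$ and $L^\circ=\{\beta\in\mathbb Q\otimes L:\langle\alpha,\beta\rangle\in\mathbb Z\ \forall\alpha\in L\}$. The set of screeners (screening momenta) of $L$ is $$\Phi=\{\beta\in L^{(0)}: \beta\notin 2L,\ 2\beta/\langle\beta,\beta\rangle\in L^\circ\}.$$ The lattice $\sqrt p\,K$ is the lattice $K$ with its form multiplied by $p$. Simply laced root lattices are normalized so that the roots are the vectors with $\langle\alpha,\alpha\rangle=2$; $A_n,D_n,E_n$ denote the root lattices of these types. A statement that a set of vectors forms a root system of a given type is meant in the usual sense in the real span of the lattice (up to overall rescaling). *)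

theory Defs
  imports
    "HOL-Analysis.Analysis"
    "HOL-Computational_Algebra.Group_Closure"
begin

section \<open>Lattices\<close>

text \<open>
  A lattice \<open>L\<close> is realised inside a real inner product space (for instance \<open>\<real> \<otimes> L\<close>), its
  bilinear form being the restriction of the inner product.  This loses no generality: a positive
  definite \<open>\<int>\<close>-valued form on a free abelian group of finite rank extends to an inner product on
  \<open>\<real> \<otimes> L\<close>.  Conversely, freeness of \<open>L\<close> and positive definiteness need not be stated separately,
  since \<open>L\<close> is a finitely generated subgroup of a real vector space with an inner product.
\<close>

definition integral_lattice :: "'a::real_inner set \<Rightarrow> bool" where
  "integral_lattice L \<longleftrightarrow>
     (\<exists>S. finite S \<and> L = group_closure S) \<and> (\<forall>x\<in>L. \<forall>y\<in>L. x \<bullet> y \<in> \<int>)"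

text \<open>The set \<open>L\<^sup>(\<^sup>0\<^sup>)\<close> of vectors of even norm.\<close>

definition even_vectors :: "'a::real_inner set \<Rightarrow> 'a set" where
  "even_vectors L = {x\<in>L. \<exists>k::int. x \<bullet> x = 2 * of_int k}"

definition even_lattice :: "'a::real_inner set \<Rightarrow> bool" where
  "even_lattice L \<longleftrightarrow> integral_lattice L \<and> (\<forall>x\<in>L. \<exists>k::int. x \<bullet> x = 2 * of_int k)"

text \<open>\<open>\<rat> \<otimes> L\<close>, embedded in the ambient space: every element of it has the form \<open>\<alpha> / k\<close>.\<close>

definition rational_span :: "'a::real_vector set \<Rightarrow> 'a set" where
  "rational_span L = {x. \<exists>k::nat. k > 0 \<and> of_nat k *\<^sub>R x \<in> L}"

definition dual_lattice :: "'a::real_inner set \<Rightarrow> 'a set" where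
  "dual_lattice L = {y \<in> rational_span L. \<forall>x\<in>L. x \<bullet> y \<in> \<int>}"

text \<open>The zero vector lies in \<open>2L\<close>, so the division below is never by zero.\<close>

definition screeners :: "'a::real_inner set \<Rightarrow> 'a set" where
  "screeners L =
     {b \<in> even_vectors L. b \<notin> (*\<^sub>R) 2 ` L \<and> (2 / (b \<bullet> b)) *\<^sub>R b \<in> dual_lattice L}"

text \<open>
  The lattice \<open>\<surd>p K\<close>: multiplying the form of \<open>K\<close> by \<open>p\<close> amounts, up to isometry, to dilating
  \<open>K\<close> by \<open>\<surd>p\<close>.
\<close>

definition sqrt_scaled :: "nat \<Rightarrow> 'a::real_inner set \<Rightarrow> 'a set" where
  "sqrt_scaled p K = (*\<^sub>R) (sqrt (real p)) ` K"

text \<open>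
  The sum is automatically direct, because the summands are pairwise orthogonal.
\<close>

definition orthogonal_direct_sum :: "'a::real_inner set \<Rightarrow> nat \<Rightarrow> (nat \<Rightarrow> 'a set) \<Rightarrow> bool" where
  "orthogonal_direct_sum L m M \<longleftrightarrow>
     (\<forall>i<m. \<forall>j<m. i \<noteq> j \<longrightarrow> (\<forall>x\<in>M i. \<forall>y\<in>M j. x \<bullet> y = 0)) \<and>
     L = {\<Sum>i<m. x i | x. \<forall>i<m. x i \<in> M i}"


section \<open>Root systems and their types\<close>

text \<open>Reduced crystallographic root systems in a subspace \<open>V\<close> of the ambient space.\<close>

definition root_system :: "'a::real_inner set \<Rightarrow> 'a set \<Rightarrow> bool" where
  "root_system V R \<longleftrightarrow>
     finite R \<and> 0 \<notin> R \<and> span R = V \<and>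
     (\<forall>a\<in>R. \<forall>b\<in>R. b - (2 * (b \<bullet> a) / (a \<bullet> a)) *\<^sub>R a \<in> R) \<and>
     (\<forall>a\<in>R. \<forall>b\<in>R. 2 * (b \<bullet> a) / (a \<bullet> a) \<in> \<int>) \<and>
     (\<forall>a\<in>R. \<forall>c. c *\<^sub>R a \<in> R \<longrightarrow> c = 1 \<or> c = -1)"

text \<open>A base (system of simple roots), enumerated as \<open>b 0, \<dots>, b (n - 1)\<close>.\<close>

definition root_base :: "'a::real_inner set \<Rightarrow> nat \<Rightarrow> (nat \<Rightarrow> 'a) \<Rightarrow> bool" where
  "root_base R n b \<longleftrightarrow>
     inj_on b {..<n} \<and> b ` {..<n} \<subseteq> R \<and> independent (b ` {..<n}) \<and>
     (\<forall>a\<in>R. \<exists>c::nat \<Rightarrow> int. a = (\<Sum>i<n. of_int (c i) *\<^sub>R b i) \<and>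
        ((\<forall>i<n. c i \<ge> 0) \<or> (\<forall>i<n. c i \<le> 0)))"

datatype dynkin_type =
  TypeA nat | TypeB nat | TypeC nat | TypeD nat | TypeE nat | TypeF4 | TypeG2

fun dynkin_rank :: "dynkin_type \<Rightarrow> nat" where
  "dynkin_rank (TypeA n) = n"
| "dynkin_rank (TypeB n) = n"
| "dynkin_rank (TypeC n) = n"
| "dynkin_rank (TypeD n) = n"
| "dynkin_rank (TypeE n) = n"
| "dynkin_rank TypeF4 = 4"
| "dynkin_rank TypeG2 = 2"

text \<open>
  Nodes are \<open>0, \<dots>, n - 1\<close>.  In types \<open>D\<^sub>n\<close> and \<open>E\<^sub>n\<close> the nodes \<open>0, \<dots>, n - 2\<close> form a chain and the
  last node \<open>n - 1\<close> is attached to the node \<open>n - 3\<close> resp. \<open>2\<close>; for \<open>E\<^sub>n\<close> this is not the Bourbaki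
  numbering.  All other diagrams are chains, with a multiple bond at the end (\<open>B\<close>, \<open>C\<close>, \<open>G\<^sub>2\<close>) or in
  the middle (\<open>F\<^sub>4\<close>).
\<close>

fun dynkin_edge :: "dynkin_type \<Rightarrow> nat \<Rightarrow> nat \<Rightarrow> bool" where
  "dynkin_edge (TypeD n) i j = (if Suc j = n then i + 2 = j else Suc i = j)"
| "dynkin_edge (TypeE n) i j = (if Suc j = n then i = 2 else Suc i = j)"
| "dynkin_edge _ i j = (Suc i = j)"

text \<open>
  For adjacent \<open>i\<close>, \<open>j\<close> the value \<open>dynkin_bond X i j\<close> is \<open>\<bar>a\<^sub>i\<^sub>j\<bar>\<close>, where
  \<open>a\<^sub>i\<^sub>j = 2\<langle>b\<^sub>i,b\<^sub>j\<rangle>/\<langle>b\<^sub>j,b\<^sub>j\<rangle>\<close>; it exceeds \<open>1\<close> exactly when \<open>b\<^sub>i\<close> is longer than \<open>b\<^sub>j\<close>.  So the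
  last simple root is the short one in type \<open>B\<^sub>n\<close> and the long one in type \<open>C\<^sub>n\<close>.
\<close>

fun dynkin_bond :: "dynkin_type \<Rightarrow> nat \<Rightarrow> nat \<Rightarrow> int" where
  "dynkin_bond (TypeB n) i j = (if Suc i = j \<and> Suc j = n then 2 else 1)"
| "dynkin_bond (TypeC n) i j = (if i = Suc j \<and> Suc i = n then 2 else 1)"
| "dynkin_bond TypeF4 i j = (if i = 1 \<and> j = 2 then 2 else 1)"
| "dynkin_bond TypeG2 i j = (if i = 1 \<and> j = 0 then 3 else 1)"
| "dynkin_bond _ i j = 1"

definition cartan_entry :: "dynkin_type \<Rightarrow> nat \<Rightarrow> nat \<Rightarrow> int" where
  "cartan_entry X i j =
     (if i = j then 2
      else if dynkin_edge X i j \<or> dynkin_edge X j i then - dynkin_bond X i j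
      else 0)"

text \<open>The type is read off from Cartan integers, hence insensitive to rescaling.\<close>

definition root_system_of_type :: "dynkin_type \<Rightarrow> 'a::real_inner set \<Rightarrow> 'a set \<Rightarrow> bool" where
  "root_system_of_type X V R \<longleftrightarrow>
     root_system V R \<and>
     (\<exists>b. root_base R (dynkin_rank X) b \<and>
        (\<forall>i<dynkin_rank X. \<forall>j<dynkin_rank X.
           2 * (b i \<bullet> b j) / (b j \<bullet> b j) = of_int (cartan_entry X i j)))"


section \<open>Simply laced root lattices\<close>

text \<open>Normalised so that the roots are exactly the lattice vectors of norm \<open>2\<close>.\<close>

definition roots :: "'a::real_inner set \<Rightarrow> 'a set" where
  "roots K = {x\<in>K. x \<bullet> x = 2}"

definition simply_laced_root_lattice :: "'a::real_inner set \<Rightarrow> bool" where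
  "simply_laced_root_lattice K \<longleftrightarrow> root_system (span K) (roots K) \<and> K = group_closure (roots K)"

text \<open>Meant for the simply laced types only; the normalisation excludes the other ones.\<close>

definition root_lattice_of_type :: "dynkin_type \<Rightarrow> 'a::real_inner set \<Rightarrow> bool" where
  "root_lattice_of_type X K \<longleftrightarrow>
     root_system_of_type X (span K) (roots K) \<and> K = group_closure (roots K)"

end

theory Submission
  imports Defs
begin

text \<open>
  The reflection in a screener preserves the lattice and hence the set of screeners.  If a screener
  \<open>b\<close> is not orthogonal to a shorter screener \<open>c\<close>, then \<open>b\<close> is, up to sign, the difference of \<open>c\<close> and
  its reflection in \<open>b\<close>.  So a lattice generated by screeners is generated by those that are
  orthogonal to all shorter ones.  Two such screeners of different norms are orthogonal, and those of
  norm \<open>2p\<close> generate \<open>\<surd>p K\<close> with \<open>K\<close> integral and generated by vectors of norm \<open>2\<close>.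

  In a lattice generated by vectors of norm \<open>2\<close>, comparing a screener \<open>b\<close> with a nonorthogonal
  generator shows that \<open>b\<close> has norm \<open>2p\<close> with \<open>p \<le> 3\<close>, and \<open>b\<close> is a screener exactly if \<open>p\<close>
  divides all its inner products.  The remaining cases \<open>p = 2\<close> and \<open>p = 3\<close> are congruence conditions
  on the coordinates of \<open>b\<close>.
\<close>

section \<open>Subgroups of a real vector space\<close>

text \<open>For a vector \<open>b\<close> of norm 2p, divisibility of all its inner products by p
  says that \<open>b / p\<close> lies in the dual lattice, with norm 2/p. So the screeners that are
  not roots come from dual vectors of norm 1 (p = 2) or 2/3 (p = 3), and the discriminant group
  decides where these exist. E_8 is unimodular and has none; the nontrivial classes of E_7 and E_6
  have norms 3/2 and 4/3 modulo 2; in the dual of A_n they exist only for n = 2 and n = 3; in the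
  dual of D_n the vectors of norm 1 are the unit vectors up to sign, joined for n = 4 by the spin
  weights, of norm n/4. A type is recognised by an explicit base. The coefficients of a root in it
  are, up to positive factors, its inner products with a dual family, and what remains is to check
  that their signs agree.\<close>

lemma group_closure_subset:
  assumes "S \<subseteq> group_closure T"
  shows "group_closure S \<subseteq> group_closure T"
proof
  fix x assume "x \<in> group_closure S"
  then show "x \<in> group_closure T"
    by induction (use assms in \<open>auto intro: group_closure.diff\<close>)
qed

lemma group_closure_mono: "S \<subseteq> T \<Longrightarrow> group_closure S \<subseteq> group_closure T"
  by (rule group_closure_subset) (auto intro: group_closure.base)

lemma group_closure_scaleR_of_int:
  fixes x :: "'a::real_vector"
  assumes "x \<in> group_closure S"
  shows "of_int k *\<^sub>R x \<in> group_closure S"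
proof -
  have *: "of_nat m *\<^sub>R x \<in> group_closure S" for m
    by (induction m) (use assms in \<open>auto simp: algebra_simps intro: group_closure_add\<close>)
  show ?thesis
  proof (cases "k \<ge> 0")
    case True
    then show ?thesis using *[of "nat k"] by simp
  next
    case False
    then have "- (of_int k *\<^sub>R x) \<in> group_closure S"
      using *[of "nat (- k)"] by simp
    then show ?thesis by (simp only: group_closure_minus_iff)
  qed
qed

lemma group_closure_sum_mem:
  assumes "\<And>i. i \<in> I \<Longrightarrow> f i \<in> group_closure S"
  shows "sum f I \<in> group_closure S"
  using assms by (induction I rule: infinite_finite_induct) (auto intro: group_closure_add)

lemma group_closure_image_eq:
  fixes b :: "nat \<Rightarrow> 'a::real_vector"
  shows "group_closure (b ` {..<n}) = {\<Sum>i<n. of_int (c i) *\<^sub>R b i | c :: nat \<Rightarrow> int. True}"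
proof (intro equalityI subsetI)
  fix x assume "x \<in> group_closure (b ` {..<n})"
  then have "\<exists>c::nat \<Rightarrow> int. x = (\<Sum>i<n. of_int (c i) *\<^sub>R b i)"
  proof induction
    case (base s)
    then consider "s = 0" | j where "j < n" "s = b j" by auto
    then show ?case
    proof cases
      case 1
      then show ?thesis by (intro exI[of _ "\<lambda>_. 0"]) simp
    next
      case 2
      have "(\<Sum>i<n. of_int (if i = j then 1 else 0) *\<^sub>R b i) = (\<Sum>i<n. if i = j then b i else 0)"
        by (intro sum.cong) auto
      then show ?thesis
        using 2 by (intro exI[of _ "\<lambda>i. if i = j then 1 else 0"]) simp
    qed
  next
    case (diff s t)
    then obtain c d :: "nat \<Rightarrow> int"
      where "s = (\<Sum>i<n. of_int (c i) *\<^sub>R b i)" "t = (\<Sum>i<n. of_int (d i) *\<^sub>R b i)" by blast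
    then show ?case
      by (intro exI[of _ "\<lambda>i. c i - d i"]) (simp add: sum_subtractf algebra_simps)
  qed
  then show "x \<in> {\<Sum>i<n. of_int (c i) *\<^sub>R b i | c :: nat \<Rightarrow> int. True}" by blast
next
  fix x assume "x \<in> {\<Sum>i<n. of_int (c i) *\<^sub>R b i | c :: nat \<Rightarrow> int. True}"
  then obtain c :: "nat \<Rightarrow> int" where x: "x = (\<Sum>i<n. of_int (c i) *\<^sub>R b i)" by blast
  show "x \<in> group_closure (b ` {..<n})"
    unfolding x
    by (intro group_closure_sum_mem group_closure_scaleR_of_int) (auto intro: group_closure.base)
qed

text \<open>Lets finitely many generators of a lattice be chosen among the short screeners without
  first knowing that these form a finite set.\<close>

lemma group_closure_finite_support:
  assumes "x \<in> group_closure S"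
  obtains T where "finite T" "T \<subseteq> S" "x \<in> group_closure T"
proof -
  from assms have "\<exists>T. finite T \<and> T \<subseteq> S \<and> x \<in> group_closure T"
  proof induction
    case (base s)
    then show ?case
      by (cases "s = 0")
        (auto intro: exI[of _ "{}"] exI[of _ "{s}"] group_closure.base)
  next
    case (diff s t)
    then obtain T T' where T: "finite T" "T \<subseteq> S" "s \<in> group_closure T"
      "finite T'" "T' \<subseteq> S" "t \<in> group_closure T'" by blast
    then show ?case
      using group_closure_mono[of T "T \<union> T'"] group_closure_mono[of T' "T \<union> T'"]
      by (intro exI[of _ "T \<union> T'"]) (auto intro: group_closure.diff)
  qed
  then show ?thesis using that by blast
qed

lemma span_group_closure: "span (group_closure S) = span S"
proof (rule antisym)
  have "x \<in> span S" if "x \<in> group_closure S" for x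
    using that by induction (auto intro: span_base span_diff span_zero)
  then show "span (group_closure S) \<subseteq> span S"
    by (simp add: span_minimal subsetI)
  show "span S \<subseteq> span (group_closure S)"
    by (rule span_mono) (auto intro: group_closure.base)
qed

lemma group_closure_inner_eq_0:
  fixes x y :: "'a::real_inner"
  assumes "x \<in> group_closure S" "y \<in> group_closure T"
    and "\<And>s t. s \<in> S \<Longrightarrow> t \<in> T \<Longrightarrow> s \<bullet> t = 0"
  shows "x \<bullet> y = 0"
proof -
  have "s \<bullet> y = 0" if "s \<in> S" for s
    using assms(2) by induction (use that assms(3) in \<open>auto simp: inner_diff_right\<close>)
  with assms(1) show ?thesis
    by induction (auto simp: inner_diff_left)
qed

lemma group_closure_inner_Ints:
  fixes x y :: "'a::real_inner"
  assumes "x \<in> group_closure S" "y \<in> group_closure T"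
    and "\<And>s t. s \<in> S \<Longrightarrow> t \<in> T \<Longrightarrow> s \<bullet> t \<in> \<int>"
  shows "x \<bullet> y \<in> \<int>"
proof -
  have "s \<bullet> y \<in> \<int>" if "s \<in> S" for s
    using assms(2) by induction (use that assms(3) in \<open>auto simp: inner_diff_right\<close>)
  with assms(1) show ?thesis
    by induction (auto simp: inner_diff_left)
qed

lemma group_closure_orthogonal_imp_0:
  fixes x :: "'a::real_inner"
  assumes "x \<in> group_closure S" "\<And>s. s \<in> S \<Longrightarrow> x \<bullet> s = 0"
  shows "x = 0"
proof -
  have "x \<bullet> x = 0"
    by (rule group_closure_inner_eq_0[of x "{x}" x S])
      (use assms in \<open>auto intro: group_closure.base\<close>)
  then show ?thesis by simp
qed

text \<open>A vector of the lattice is determined by its inner products with the generators, because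
  a difference orthogonal to all of them is orthogonal to itself. These inner products are integers,
  bounded by Cauchy--Schwarz.\<close>

lemma finite_bounded_vectors:
  fixes S :: "'a::real_inner set"
  assumes "finite S" and int: "\<And>x y. x \<in> group_closure S \<Longrightarrow> y \<in> group_closure S \<Longrightarrow> x \<bullet> y \<in> \<int>"
  shows "finite {x \<in> group_closure S. x \<bullet> x \<le> N}"
proof -
  define f where "f = (\<lambda>x. restrict (\<lambda>s. x \<bullet> s) S)"
  define P where "P = Pi\<^sub>E S (\<lambda>s. {k \<in> \<int>. \<bar>k\<bar> \<le> sqrt N * norm s})"
  have "finite P"
    unfolding P_def using \<open>finite S\<close> by (intro finite_PiE finite_abs_int_segment) auto
  moreover have "f ` {x \<in> group_closure S. x \<bullet> x \<le> N} \<subseteq> P"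
  proof (clarsimp simp: f_def P_def)
    fix x s assume x: "x \<in> group_closure S" "x \<bullet> x \<le> N" and s: "s \<in> S"
    have "x \<bullet> s \<in> \<int>" using int x s by (auto intro: group_closure.base)
    moreover have "norm x \<le> sqrt N" using x by (simp add: norm_eq_sqrt_inner)
    then have "\<bar>x \<bullet> s\<bar> \<le> sqrt N * norm s"
      by (meson Cauchy_Schwarz_ineq2 mult_right_mono norm_ge_zero order_trans)
    ultimately show "x \<bullet> s \<in> \<int> \<and> \<bar>x \<bullet> s\<bar> \<le> sqrt N * norm s" by blast
  qed
  moreover have "inj_on f {x \<in> group_closure S. x \<bullet> x \<le> N}"
  proof (rule inj_onI, clarsimp)
    fix x y assume xy: "x \<in> group_closure S" "y \<in> group_closure S" and f: "f x = f y"
    have "(x - y) \<bullet> s = 0" if "s \<in> S" for s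
      using fun_cong[OF f, of s] that by (simp add: f_def inner_diff_left)
    then show "x = y"
      using group_closure_orthogonal_imp_0[of "x - y" S] xy by (auto intro: group_closure.diff)
  qed
  ultimately show ?thesis by (meson finite_subset finite_imageD)
qed


section \<open>Screeners and reflections\<close>

definition reflect :: "'a::real_inner \<Rightarrow> 'a \<Rightarrow> 'a" where
  "reflect a x = x - (2 * (x \<bullet> a) / (a \<bullet> a)) *\<^sub>R a"

lemma reflect_inner: "reflect a x \<bullet> reflect a y = x \<bullet> y"
  by (cases "a = 0")
    (simp_all add: reflect_def inner_diff_left inner_diff_right inner_commute field_simps)

lemma reflect_reflect [simp]: "reflect a (reflect a x) = x"
  by (cases "a = 0") (simp_all add: reflect_def inner_diff_left)

lemma reflect_scaleR: "reflect a (c *\<^sub>R x) = c *\<^sub>R reflect a x"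
  by (simp add: reflect_def algebra_simps)

lemma screenersD:
  assumes "b \<in> screeners L"
  shows "b \<in> L" "b \<notin> (*\<^sub>R) 2 ` L" "\<exists>k::int. b \<bullet> b = 2 * of_int k"
    and "x \<in> L \<Longrightarrow> 2 * (x \<bullet> b) / (b \<bullet> b) \<in> \<int>"
  using assms by (auto simp: screeners_def even_vectors_def dual_lattice_def)

text \<open>The integer \<open>b \<bullet> b\<close> clears the denominator, so lying in
  \<open>rational_span L\<close> is automatic and only integrality has to be checked.\<close>

lemma screenersI:
  assumes b: "b \<in> L" "b \<notin> (*\<^sub>R) 2 ` L" "b \<bullet> b = 2 * of_int k" and L: "L = group_closure S"
    and dual: "\<And>x. x \<in> L \<Longrightarrow> 2 * (x \<bullet> b) / (b \<bullet> b) \<in> \<int>"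
  shows "b \<in> screeners L"
proof -
  have "0 \<in> (*\<^sub>R) 2 ` L"
    unfolding L by (intro image_eqI[of _ _ 0]) auto
  then have "b \<bullet> b > 0" using b(2) by auto
  then have k: "k > 0" using b(3) by simp
  have "of_nat (nat (2 * k)) *\<^sub>R ((2 / (b \<bullet> b)) *\<^sub>R b) = of_int 2 *\<^sub>R b"
    using k b(3) by simp
  also have "\<dots> \<in> L"
    using b(1) unfolding L by (rule group_closure_scaleR_of_int)
  finally have "(2 / (b \<bullet> b)) *\<^sub>R b \<in> rational_span L"
    unfolding rational_span_def using k by (intro CollectI exI[of _ "nat (2 * k)"]) simp
  then show ?thesis
    using b dual by (auto simp: screeners_def even_vectors_def dual_lattice_def)
qed

lemma zero_not_screener: "0 \<notin> screeners (group_closure S)"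
proof
  assume "0 \<in> screeners (group_closure S)"
  moreover have "(0::'a) \<in> (*\<^sub>R) 2 ` group_closure S"
    by (intro image_eqI[of _ _ 0]) auto
  ultimately show False using screenersD(2) by blast
qed

lemma reflect_screener_lattice:
  assumes "a \<in> screeners L" "x \<in> L" "L = group_closure S"
  shows "reflect a x \<in> L"
proof -
  obtain k :: int where "2 * (x \<bullet> a) / (a \<bullet> a) = of_int k"
    using screenersD(4)[OF assms(1,2)] by (auto elim: Ints_cases)
  then have "reflect a x = x - of_int k *\<^sub>R a" by (simp add: reflect_def)
  also have "\<dots> \<in> L"
    using assms screenersD(1)[OF assms(1)]
    by (auto intro: group_closure.diff group_closure_scaleR_of_int)
  finally show ?thesis .
qed

lemma reflect_screener:
  assumes a: "a \<in> screeners L" and b: "b \<in> screeners L" and L: "L = group_closure S"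
  shows "reflect a b \<in> screeners L"
proof -
  note r = reflect_screener_lattice[OF a _ L]
  obtain k :: int where k: "b \<bullet> b = 2 * of_int k"
    using screenersD(3)[OF b] by blast
  show ?thesis
  proof (rule screenersI[OF _ _ _ L, where k = k])
    show "reflect a b \<in> L" using r screenersD(1)[OF b] .
    show "reflect a b \<notin> (*\<^sub>R) 2 ` L"
    proof
      assume "reflect a b \<in> (*\<^sub>R) 2 ` L"
      then obtain d where "d \<in> L" "reflect a b = 2 *\<^sub>R d" by blast
      then have "b = 2 *\<^sub>R reflect a d" "reflect a d \<in> L"
        using r by (auto simp flip: reflect_scaleR) (metis reflect_reflect)
      then show False using screenersD(2)[OF b] by blast
    qed
    show "reflect a b \<bullet> reflect a b = 2 * of_int k" using k by (simp add: reflect_inner)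
    show "2 * (x \<bullet> reflect a b) / (reflect a b \<bullet> reflect a b) \<in> \<int>" if "x \<in> L" for x
      using screenersD(4)[OF b r[OF that]] reflect_inner[of a "reflect a x" b]
      by (simp add: reflect_inner)
  qed
qed

lemma uminus_screener:
  assumes "b \<in> screeners L" "L = group_closure S"
  shows "- b \<in> screeners L"
proof -
  have "b \<noteq> 0" using assms zero_not_screener by blast
  then have "reflect b b = - b" by (simp add: reflect_def scaleR_2)
  then show ?thesis using reflect_screener[OF assms(1,1,2)] by simp
qed

text \<open>Pairing \<open>a\<close> and its multiple with each other makes 2c and 2/c integers with
  product 4, so c is 1/2, 1 or 2 up to sign. The values 2 and 1/2 would put one of the two screeners
  into 2L. This gives the reducedness of the root system.\<close>

lemma screener_multiple:
  assumes a: "a \<in> screeners L" and ca: "c *\<^sub>R a \<in> screeners L" and L: "L = group_closure S"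
  shows "c = 1 \<or> c = - 1"
proof -
  have "a \<noteq> 0" "c *\<^sub>R a \<noteq> 0" using a ca L zero_not_screener by metis+
  then have a0: "a \<bullet> a > 0" "c \<noteq> 0" by auto
  have "2 * c \<in> \<int>" "2 / c \<in> \<int>"
    using screenersD(4)[OF a screenersD(1)[OF ca]] screenersD(4)[OF ca screenersD(1)[OF a]] a0
    by simp_all
  then obtain k l :: int where kl: "2 * c = of_int k" "2 / c = of_int l" by (auto elim!: Ints_cases)
  then have "of_int (k * l) = (4::real)" using a0 by (simp flip: kl)
  then have kl4: "k * l = 4" by linarith
  then have "\<bar>k\<bar> dvd 4" by (metis abs_dvd_iff dvd_triv_left)
  then have "\<bar>k\<bar> \<le> 4" by (simp add: zdvd_imp_le)
  then have "k \<in> {-4,-3,-2,-1,0,1,2,3,4}" by auto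
  then have "k \<in> {-4,-2,-1,1,2,4}" using kl4 by auto presburger+
  moreover have "k \<noteq> 4 \<and> k \<noteq> -4"
  proof -
    have "c \<noteq> 2 \<and> c \<noteq> -2"
      using screenersD(2)[OF ca] screenersD(1)[OF a] screenersD(1)[OF uminus_screener[OF a L]]
      by (metis imageI scaleR_minus_left scaleR_minus_right)
    then show ?thesis using kl(1) by auto
  qed
  moreover have "k \<noteq> 1 \<and> k \<noteq> -1"
  proof -
    have "c \<noteq> 1/2 \<and> c \<noteq> -1/2"
    proof (intro conjI notI)
      assume c: "c = 1/2"
      have "a = 2 *\<^sub>R (c *\<^sub>R a)" unfolding c by simp
      then show False using screenersD(2)[OF a] screenersD(1)[OF ca] by blast
    next
      assume c: "c = -1/2"
      have "a = 2 *\<^sub>R (- (c *\<^sub>R a))" unfolding c by simp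
      then show False
        using screenersD(2)[OF a] screenersD(1)[OF uminus_screener[OF ca L]] by blast
    qed
    then show ?thesis using kl(1) by auto
  qed
  ultimately show ?thesis using kl(1) by auto
qed

lemma root_system_screeners:
  assumes "L = group_closure S" "finite (screeners L)" "span (screeners L) = V"
  shows "root_system V (screeners L)"
  unfolding root_system_def
proof (intro conjI ballI allI impI)
  show "0 \<notin> screeners L" using assms zero_not_screener by blast
  show "b - (2 * (b \<bullet> a) / (a \<bullet> a)) *\<^sub>R a \<in> screeners L"
    if "a \<in> screeners L" "b \<in> screeners L" for a b
    using reflect_screener[OF that assms(1)] by (simp add: reflect_def)
  show "2 * (b \<bullet> a) / (a \<bullet> a) \<in> \<int>" if "a \<in> screeners L" "b \<in> screeners L" for a b
    using screenersD(1,4) that by blast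
  show "c = 1 \<or> c = - 1" if "a \<in> screeners L" "c *\<^sub>R a \<in> screeners L" for a c
    using screener_multiple that assms(1) by blast
qed (use assms in auto)

section \<open>Lattices generated by vectors of norm 2\<close>

locale norm2_lattice =
  fixes S K :: "'a::real_inner set"
  assumes finite_generators: "finite S"
    and lattice_eq: "K = group_closure S"
    and norm_generators: "s \<in> S \<Longrightarrow> s \<bullet> s = 2"
    and inner_generators: "s \<in> S \<Longrightarrow> t \<in> S \<Longrightarrow> s \<bullet> t \<in> \<int>"
begin

lemma generators_subset: "S \<subseteq> K"
  unfolding lattice_eq by (auto intro: group_closure.base)

lemma inner_Ints: "x \<in> K \<Longrightarrow> y \<in> K \<Longrightarrow> x \<bullet> y \<in> \<int>"
  unfolding lattice_eq using group_closure_inner_Ints inner_generators by metis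

lemma even_norm: "x \<in> K \<Longrightarrow> \<exists>k::int. x \<bullet> x = 2 * of_int k"
proof -
  assume "x \<in> K"
  then show ?thesis
    unfolding lattice_eq
  proof induction
    case (base s)
    then show ?case
      by (cases "s = 0") (auto intro: exI[of _ 0] exI[of _ 1] simp: norm_generators)
  next
    case (diff s t)
    then obtain k l :: int where kl: "s \<bullet> s = 2 * of_int k" "t \<bullet> t = 2 * of_int l" by blast
    have "s \<bullet> t \<in> \<int>" using diff.hyps inner_Ints by (simp add: lattice_eq)
    then obtain m :: int where m: "s \<bullet> t = of_int m" by (rule Ints_cases)
    show ?case
      using kl m
      by (intro exI[of _ "k + l - m"]) (simp add: inner_diff_left inner_diff_right inner_commute)
  qed
qed

lemma finite_bounded: "finite {x \<in> K. x \<bullet> x \<le> N}"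
  using finite_bounded_vectors[OF finite_generators] inner_Ints unfolding lattice_eq by blast

lemma simply_laced: "simply_laced_root_lattice K"
  unfolding simply_laced_root_lattice_def root_system_def
proof (intro conjI ballI allI impI)
  show "finite (roots K)"
    by (rule finite_subset[OF _ finite_bounded[of 2]]) (auto simp: roots_def)
  show "0 \<notin> roots K" by (auto simp: roots_def)
  have S: "S \<subseteq> roots K" using generators_subset norm_generators by (auto simp: roots_def)
  have "span (roots K) \<subseteq> span K" by (intro span_mono) (auto simp: roots_def)
  moreover have "span K \<subseteq> span (roots K)"
    using span_mono[OF S] by (simp add: lattice_eq span_group_closure)
  ultimately show "span (roots K) = span K" by blast
  show "K = group_closure (roots K)"
  proof
    show "K \<subseteq> group_closure (roots K)" using group_closure_mono[OF S] lattice_eq by simp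
    have "group_closure (roots K) \<subseteq> group_closure S"
      by (rule group_closure_subset) (auto simp: roots_def lattice_eq)
    then show "group_closure (roots K) \<subseteq> K" using lattice_eq by simp
  qed
  show "2 * (b \<bullet> a) / (a \<bullet> a) \<in> \<int>" if "a \<in> roots K" "b \<in> roots K" for a b
    using that inner_Ints by (auto simp: roots_def)
  show "b - (2 * (b \<bullet> a) / (a \<bullet> a)) *\<^sub>R a \<in> roots K" if "a \<in> roots K" "b \<in> roots K" for a b
  proof -
    have ab: "a \<in> K" "b \<in> K" "a \<bullet> a = 2" "b \<bullet> b = 2" using that by (auto simp: roots_def)
    have "b \<bullet> a \<in> \<int>" using inner_Ints ab by blast
    then obtain k :: int where k: "b \<bullet> a = of_int k" by (rule Ints_cases)
    have "b - of_int k *\<^sub>R a \<in> K"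
      using ab unfolding lattice_eq by (intro group_closure.diff group_closure_scaleR_of_int)
    then show ?thesis
      using reflect_inner[of a b b] ab k by (simp add: roots_def reflect_def)
  qed
  show "c = 1 \<or> c = - 1" if "a \<in> roots K" "c *\<^sub>R a \<in> roots K" for a c
  proof -
    have "c * c = 1" using that by (simp add: roots_def)
    then show ?thesis by (simp add: square_eq_1_iff)
  qed
qed

text \<open>The lattice is even, so a nonzero vector has norm at least 2 and its double has norm at
  least 8. This settles the norms 2, 4 and 6 that occur for screeners.\<close>

lemma small_not_double:
  assumes "b \<bullet> b < 8" "b \<noteq> 0"
  shows "b \<notin> (*\<^sub>R) 2 ` K"
proof
  assume "b \<in> (*\<^sub>R) 2 ` K"
  then obtain d where d: "d \<in> K" "b = 2 *\<^sub>R d" by blast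
  obtain k :: int where k: "d \<bullet> d = 2 * of_int k" using even_norm d(1) by blast
  have "d \<bullet> d > 0" using assms d by simp
  moreover have "d \<bullet> d < 2" using assms d by simp
  ultimately have "0 < k" "k < 1" unfolding k by linarith+
  then show False by simp
qed

lemma screenerI:
  assumes b: "b \<in> K" "b \<bullet> b = 2 * of_int p" and p: "0 < p" "p < 4"
    and dvd: "\<And>x. x \<in> K \<Longrightarrow> \<exists>k::int. x \<bullet> b = of_int (p * k)"
  shows "b \<in> screeners K"
proof (rule screenersI[OF b(1) _ b(2) lattice_eq])
  show "b \<notin> (*\<^sub>R) 2 ` K" using b p by (intro small_not_double) auto
  show "2 * (x \<bullet> b) / (b \<bullet> b) \<in> \<int>" if "x \<in> K" for x
    using dvd[OF that] p b(2) by auto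
qed

lemma roots_subset_screeners: "roots K \<subseteq> screeners K"
proof
  fix b assume "b \<in> roots K"
  then have b: "b \<in> K" "b \<bullet> b = 2" by (auto simp: roots_def)
  show "b \<in> screeners K"
  proof (rule screenerI[where p = 1])
    show "\<exists>k::int. x \<bullet> b = of_int (1 * k)" if "x \<in> K" for x
      using Ints_cases[OF inner_Ints[OF that b(1)]] by auto
  qed (use b in auto)
qed

text \<open>
  Writing \<open>b \<bullet> b = 2p\<close> and \<open>b \<bullet> s = pk\<close> for a generator \<open>s\<close> not orthogonal to \<open>b\<close>, the
  Cauchy--Schwarz inequality gives \<open>p k\<^sup>2 \<le> 4\<close>; the case \<open>p = 4\<close> is \<open>b = \<plusminus>2s\<close>.
\<close>
lemma screenerE:
  assumes b: "b \<in> screeners K"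
  obtains p :: int where "p \<in> {1, 2, 3}" "b \<bullet> b = 2 * of_int p"
    "\<And>x. x \<in> K \<Longrightarrow> \<exists>k::int. x \<bullet> b = of_int (p * k)"
proof -
  have bK: "b \<in> K" and b2: "b \<notin> (*\<^sub>R) 2 ` K" using screenersD[OF b] by blast+
  obtain p :: int where p: "b \<bullet> b = 2 * of_int p" using screenersD(3)[OF b] by blast
  have b0: "b \<noteq> 0" using b zero_not_screener unfolding lattice_eq by metis
  then have "b \<bullet> b > 0" by simp
  then have p0: "p > 0" using p by simp
  have dvd: "\<exists>k::int. x \<bullet> b = of_int (p * k)" if "x \<in> K" for x
  proof -
    have "2 * (x \<bullet> b) / (b \<bullet> b) \<in> \<int>" using screenersD(4)[OF b that] .
    then obtain k :: int where "2 * (x \<bullet> b) / (b \<bullet> b) = of_int k" by (rule Ints_cases)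
    then have "x \<bullet> b = of_int (p * k)" using p p0 by (simp add: field_simps)
    then show ?thesis by blast
  qed
  obtain s where s: "s \<in> S" "b \<bullet> s \<noteq> 0"
    using group_closure_orthogonal_imp_0 b0 bK unfolding lattice_eq by blast
  have s2: "s \<bullet> s = 2" and sK: "s \<in> K" using s(1) norm_generators generators_subset by auto
  obtain k :: int where k: "s \<bullet> b = of_int (p * k)" using dvd[OF sK] by blast
  have "k \<noteq> 0" using k s(2) by (auto simp: inner_commute)
  have "(s \<bullet> b)\<^sup>2 \<le> (s \<bullet> s) * (b \<bullet> b)" by (rule Cauchy_Schwarz_ineq)
  then have "of_int ((p * k)\<^sup>2) \<le> (of_int (4 * p) :: real)" using k s2 p by simp
  then have "(p * k)\<^sup>2 \<le> 4 * p" by linarith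
  then have "p * (p * k\<^sup>2) \<le> p * 4" by (simp add: power2_eq_square mult_ac)
  then have pk: "p * k\<^sup>2 \<le> 4" using p0 by simp
  have k1: "k\<^sup>2 \<ge> 1" using \<open>k \<noteq> 0\<close> by (simp add: int_one_le_iff_zero_less)
  then have "p * 1 \<le> p * k\<^sup>2" using p0 by (intro mult_left_mono) auto
  then have "p \<le> 4" using pk by linarith
  moreover have "p \<noteq> 4"
  proof
    assume p4: "p = 4"
    then have "k\<^sup>2 = 1" using pk k1 by simp
    then have k': "k = 1 \<or> k = - 1" by (simp add: power2_eq_1_iff)
    have "(b - of_int (2 * k) *\<^sub>R s) \<bullet> (b - of_int (2 * k) *\<^sub>R s) = 0"
      using k' k s2 p p4 by (auto simp: inner_diff_left inner_diff_right inner_add_left inner_add_right inner_commute)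
    then have "b = 2 *\<^sub>R (of_int k *\<^sub>R s)" by simp
    moreover have "of_int k *\<^sub>R s \<in> K"
      using sK unfolding lattice_eq by (rule group_closure_scaleR_of_int)
    ultimately show False using b2 by blast
  qed
  ultimately have "p \<in> {1, 2, 3}" using p0 by auto
  then show ?thesis using that[OF _ p dvd] by simp
qed

lemma nonroot_screenerE:
  assumes "b \<in> screeners K - roots K"
  obtains p :: int where "p \<in> {2, 3}" "b \<bullet> b = 2 * of_int p"
    "\<And>x. x \<in> K \<Longrightarrow> \<exists>k::int. x \<bullet> b = of_int (p * k)"
proof -
  from assms have "b \<in> screeners K" by blast
  then show ?thesis
  proof (rule screenerE)
    fix p :: int
    assume p: "p \<in> {1, 2, 3}" "b \<bullet> b = 2 * of_int p"
      "\<And>x. x \<in> K \<Longrightarrow> \<exists>k::int. x \<bullet> b = of_int (p * k)"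
    have "p \<noteq> 1" using assms p(2) screenersD(1) by (auto simp: roots_def)
    then show ?thesis using that[of p] p by auto
  qed
qed

lemma root_system_screeners: "root_system (span K) (screeners K)"
proof (rule root_system_screeners[OF lattice_eq])
  have "b \<bullet> b \<le> 6" if "b \<in> screeners K" for b
  proof -
    from that obtain p :: int where "p \<in> {1, 2, 3}" "b \<bullet> b = 2 * of_int p" by (rule screenerE)
    then show ?thesis by auto
  qed
  then show "finite (screeners K)"
    by (intro finite_subset[OF _ finite_bounded[of 6]]) (auto dest: screenersD(1))
  have "span (screeners K) \<subseteq> span K" by (intro span_mono) (auto dest: screenersD(1))
  moreover have "S \<subseteq> screeners K"
    using roots_subset_screeners generators_subset norm_generators by (auto simp: roots_def)
  then have "span K \<subseteq> span (screeners K)"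
    unfolding lattice_eq span_group_closure by (rule span_mono)
  ultimately show "span (screeners K) = span K" by blast
qed

end

section \<open>Lattices generated by screeners\<close>

text \<open>
  Here \<open>c\<close> and its reflection in \<open>b\<close> do the job: they have the same norm, and because \<open>c\<close> is the
  shorter vector they differ by exactly \<open>\<plusminus>b\<close>.
\<close>
lemma longer_screener_in_closure:
  assumes L: "L = group_closure S"
    and b: "b \<in> screeners L" and c: "c \<in> screeners L" "c \<bullet> c < b \<bullet> b" "b \<bullet> c \<noteq> 0"
  shows "\<exists>d\<in>screeners L. \<exists>e\<in>screeners L. d \<bullet> d < b \<bullet> b \<and> e \<bullet> e < b \<bullet> b \<and> b = d - e"
proof -
  have b0: "b \<bullet> b > 0" and c0: "c \<bullet> c > 0" using c(3) by auto
  obtain k :: int where k: "2 * (c \<bullet> b) / (b \<bullet> b) = of_int k"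
    using screenersD(1)[OF c(1)] screenersD(4)[OF b] by (auto elim: Ints_cases)
  have "(c \<bullet> b)\<^sup>2 \<le> (c \<bullet> c) * (b \<bullet> b)" by (rule Cauchy_Schwarz_ineq)
  also have "\<dots> < (b \<bullet> b) * (b \<bullet> b)" using c b0 by simp
  finally have "\<bar>c \<bullet> b\<bar>\<^sup>2 < (b \<bullet> b)\<^sup>2" by (simp add: power2_eq_square)
  then have "\<bar>c \<bullet> b\<bar> < b \<bullet> b" by (rule power2_less_imp_less) simp
  then have "\<bar>of_int k :: real\<bar> < 2" using b0 by (simp flip: k add: abs_mult field_simps)
  then have "\<bar>k\<bar> < 2" by linarith
  moreover have "k \<noteq> 0" using k c(3) b0 by (auto simp: inner_commute)
  ultimately have k': "k = 1 \<or> k = - 1" by linarith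
  define e where "e = reflect b c"
  have e: "e \<in> screeners L" "e \<bullet> e = c \<bullet> c" "e = c - of_int k *\<^sub>R b"
    using reflect_screener[OF b c(1) L] k by (auto simp: e_def reflect_inner) (simp add: reflect_def)
  from k' show ?thesis
  proof
    assume "k = 1"
    then have "b = c - e" using e(3) by simp
    then show ?thesis using e c by metis
  next
    assume "k = - 1"
    then have "b = e - c" using e(3) by simp
    then show ?thesis using e c by metis
  qed
qed

definition short_screeners :: "'a::real_inner set \<Rightarrow> 'a set" where
  "short_screeners L = {b \<in> screeners L. \<forall>c\<in>screeners L. c \<bullet> c < b \<bullet> b \<longrightarrow> b \<bullet> c = 0}"

lemma screeners_in_closure_short:
  assumes L: "L = group_closure S" and b: "b \<in> screeners L"
  shows "b \<in> group_closure (short_screeners L)"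
proof -
  \<comment> \<open>Norms of screeners are natural numbers; naming the norm \<open>m\<close> makes
    the descent to shorter vectors a well-founded induction.\<close>
  have "\<forall>b\<in>screeners L. b \<bullet> b = real m \<longrightarrow> b \<in> group_closure (short_screeners L)" for m
  proof (induction m rule: less_induct)
    case (less m)
    show ?case
    proof (intro ballI impI)
      fix b assume b: "b \<in> screeners L" "b \<bullet> b = real m"
      have smaller: "d \<in> group_closure (short_screeners L)"
        if d: "d \<in> screeners L" "d \<bullet> d < b \<bullet> b" for d
      proof -
        obtain k :: int where k: "d \<bullet> d = 2 * of_int k" using screenersD(3)[OF d(1)] by blast
        then have "k \<ge> 0" using inner_ge_zero[of d] by simp
        then have "d \<bullet> d = real (nat (2 * k))" using k by simp
        moreover from this have "nat (2 * k) < m" using d(2) b(2) by simp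
        ultimately show ?thesis using less.IH d(1) by blast
      qed
      show "b \<in> group_closure (short_screeners L)"
      proof (cases "b \<in> short_screeners L")
        case True
        then show ?thesis by (auto intro: group_closure.base)
      next
        case False
        then obtain c where "c \<in> screeners L" "c \<bullet> c < b \<bullet> b" "b \<bullet> c \<noteq> 0"
          using b by (auto simp: short_screeners_def)
        then show ?thesis
          using longer_screener_in_closure[OF L b(1)] smaller by (metis group_closure.diff)
      qed
    qed
  qed
  moreover obtain k :: int where k: "b \<bullet> b = 2 * of_int k" using screenersD(3)[OF b] by blast
  moreover from k have "k \<ge> 0" using inner_ge_zero[of b] by simp
  then have "b \<bullet> b = real (nat (2 * k))" using k by simp
  ultimately show ?thesis using b by blast
qed

lemma short_screeners_orthogonal:
  assumes "b \<in> short_screeners L" "c \<in> short_screeners L" "b \<bullet> b \<noteq> c \<bullet> c"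
  shows "b \<bullet> c = 0"
proof -
  have *: "b \<bullet> c = 0" if "b \<in> short_screeners L" "c \<in> short_screeners L" "c \<bullet> c < b \<bullet> b" for b c
    using that unfolding short_screeners_def by blast
  show ?thesis
    using *[OF assms(1,2)] *[OF assms(2,1)] assms(3) by (metis inner_commute linorder_neqE)
qed

lemma group_closure_scaleR_image:
  fixes T :: "'a::real_vector set"
  shows "(*\<^sub>R) r ` group_closure T = group_closure ((*\<^sub>R) r ` T)"
proof (intro equalityI subsetI)
  fix x assume "x \<in> (*\<^sub>R) r ` group_closure T"
  then obtain y where y: "y \<in> group_closure T" "x = r *\<^sub>R y" by blast
  from y(1) have "r *\<^sub>R y \<in> group_closure ((*\<^sub>R) r ` T)"
  proof induction
    case (base s)
    then have "r *\<^sub>R s \<in> (*\<^sub>R) r ` insert 0 T" by (rule imageI)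
    then show ?case by (intro group_closure.base) simp
  qed (simp add: scaleR_diff_right group_closure.diff)
  then show "x \<in> group_closure ((*\<^sub>R) r ` T)" using y(2) by simp
next
  fix x assume "x \<in> group_closure ((*\<^sub>R) r ` T)"
  then show "x \<in> (*\<^sub>R) r ` group_closure T"
  proof induction
    case (base s)
    have "insert 0 ((*\<^sub>R) r ` T) = (*\<^sub>R) r ` insert 0 T" by simp
    with base obtain u where "u \<in> insert 0 T" "s = r *\<^sub>R u" by blast
    then show ?case by (intro image_eqI[of _ _ u]) (auto intro: group_closure.base)
  next
    case (diff s t)
    then obtain u v where "u \<in> group_closure T" "v \<in> group_closure T" "s = r *\<^sub>R u" "t = r *\<^sub>R v"
      by blast
    then show ?case
      by (intro image_eqI[of _ _ "u - v"]) (simp_all add: scaleR_diff_right group_closure.diff)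
  qed
qed

lemma orthogonal_direct_sum_group_closure:
  assumes orth: "\<And>i j x y. i < m \<Longrightarrow> j < m \<Longrightarrow> i \<noteq> j \<Longrightarrow> x \<in> T i \<Longrightarrow> y \<in> T j \<Longrightarrow> x \<bullet> y = 0"
  shows "orthogonal_direct_sum (group_closure (\<Union>i<m. T i)) m (\<lambda>i. group_closure (T i))"
  unfolding orthogonal_direct_sum_def
proof (intro conjI allI impI ballI equalityI subsetI)
  show "x \<bullet> y = 0"
    if "i < m" "j < m" "i \<noteq> j" "x \<in> group_closure (T i)" "y \<in> group_closure (T j)" for i j x y
    using group_closure_inner_eq_0[OF that(4,5) orth[OF that(1-3)]] .
next
  fix x assume "x \<in> group_closure (\<Union>i<m. T i)"
  then have "\<exists>f. x = (\<Sum>i<m. f i) \<and> (\<forall>i<m. f i \<in> group_closure (T i))"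
  proof induction
    case (base s)
    then consider "s = 0" | j where "j < m" "s \<in> T j" by auto
    then show ?case
    proof cases
      case 1
      then show ?thesis by (intro exI[of _ "\<lambda>_. 0"]) simp
    next
      case 2
      then show ?thesis
        by (intro exI[of _ "\<lambda>i. if i = j then s else 0"]) (auto intro: group_closure.base)
    qed
  next
    case (diff s t)
    then obtain f g where "s = (\<Sum>i<m. f i)" "\<forall>i<m. f i \<in> group_closure (T i)"
      "t = (\<Sum>i<m. g i)" "\<forall>i<m. g i \<in> group_closure (T i)" by blast
    then show ?case
      by (intro exI[of _ "\<lambda>i. f i - g i"]) (auto simp: sum_subtractf intro: group_closure.diff)
  qed
  then show "x \<in> {\<Sum>i<m. f i |f. \<forall>i<m. f i \<in> group_closure (T i)}" by blast
next
  fix x assume "x \<in> {\<Sum>i<m. f i |f. \<forall>i<m. f i \<in> group_closure (T i)}"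
  then obtain f where f: "x = (\<Sum>i<m. f i)" "\<forall>i<m. f i \<in> group_closure (T i)" by blast
  have "group_closure (T i) \<subseteq> group_closure (\<Union>i<m. T i)" if "i < m" for i
    using that by (intro group_closure_mono) blast
  then show "x \<in> group_closure (\<Union>i<m. T i)"
    unfolding f(1) using f(2) by (intro group_closure_sum_mem) auto
qed

lemma screener_lattice_decomposition:
  fixes L :: "'a::real_inner set"
  assumes even: "even_lattice L" and gen: "L = group_closure (screeners L)"
  shows "\<exists>m p K. (\<forall>i<m. p i > 0 \<and> simply_laced_root_lattice (K i)) \<and>
           orthogonal_direct_sum L m (\<lambda>i. sqrt_scaled (p i) (K i))"
proof -
  obtain F where F: "finite F" "L = group_closure F"
    using even by (auto simp: even_lattice_def integral_lattice_def)
  have sub: "short_screeners L \<subseteq> L"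
    by (auto simp: short_screeners_def dest: screenersD(1))
  have "screeners L \<subseteq> group_closure (short_screeners L)"
    using screeners_in_closure_short[OF F(2)] by blast
  then have "L \<subseteq> group_closure (short_screeners L)"
    using gen group_closure_subset by blast
  then have "\<forall>f\<in>F. \<exists>T. finite T \<and> T \<subseteq> short_screeners L \<and> f \<in> group_closure T"
    using F(2) by (metis group_closure.base group_closure_finite_support insertI2 subsetD)
  then obtain T where T: "\<And>f. f \<in> F \<Longrightarrow> finite (T f) \<and> T f \<subseteq> short_screeners L \<and> f \<in> group_closure (T f)"
    by metis
  define U where "U = (\<Union>f\<in>F. T f)"
  have U: "finite U" "U \<subseteq> short_screeners L" using T F(1) by (auto simp: U_def)
  have "F \<subseteq> group_closure U"
  proof
    fix f assume "f \<in> F"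
    then show "f \<in> group_closure U"
      using T group_closure_mono[of "T f" U] by (auto simp: U_def)
  qed
  then have "L \<subseteq> group_closure U" unfolding F(2) by (rule group_closure_subset)
  moreover have "group_closure U \<subseteq> L"
    unfolding F(2) using U(2) sub F(2) by (intro group_closure_subset) auto
  ultimately have LU: "L = group_closure U" by blast
  \<comment> \<open>Index \<open>i\<close> collects the generators of norm 2(i + 1), so the scale
    \<open>Suc i\<close> is positive for every index. An index without generators contributes the
    zero lattice, which counts as a root lattice with no roots.\<close>
  define Ui where "Ui = (\<lambda>i. {u \<in> U. u \<bullet> u = 2 * real (Suc i)})"
  define K where "K = (\<lambda>i. group_closure ((*\<^sub>R) (1 / sqrt (real (Suc i))) ` Ui i))"
  have scr: "u \<in> screeners L" if "u \<in> U" for u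
    using that U(2) by (auto simp: short_screeners_def)
  have "\<exists>i. u \<in> Ui i" if "u \<in> U" for u
  proof -
    have u: "u \<in> screeners L" using scr that by blast
    obtain k :: int where k: "u \<bullet> u = 2 * of_int k" using screenersD(3)[OF u] by blast
    have "u \<noteq> 0" using u zero_not_screener F(2) by metis
    then have "u \<bullet> u > 0" by simp
    then have "k > 0" using k by simp
    then have "u \<bullet> u = 2 * real (Suc (nat (k - 1)))" using k by simp
    then show ?thesis using that by (auto simp: Ui_def)
  qed
  then obtain g where g: "\<And>u. u \<in> U \<Longrightarrow> u \<in> Ui (g u)" by metis
  obtain m where m: "\<And>u. u \<in> U \<Longrightarrow> g u < m"
    using U(1) finite_nat_set_iff_bounded[of "g ` U"] by auto
  have Um: "U = (\<Union>i<m. Ui i)"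
  proof
    show "U \<subseteq> (\<Union>i<m. Ui i)" using g m by blast
  qed (auto simp: Ui_def)
  have "orthogonal_direct_sum L m (\<lambda>i. group_closure (Ui i))"
    unfolding LU Um
  proof (rule orthogonal_direct_sum_group_closure)
    fix i j x y assume "i \<noteq> j" "x \<in> Ui i" "y \<in> Ui j"
    then show "x \<bullet> y = 0"
      using U(2) by (intro short_screeners_orthogonal) (auto simp: Ui_def)
  qed
  moreover have "sqrt_scaled (Suc i) (K i) = group_closure (Ui i)" for i
    by (simp add: sqrt_scaled_def K_def group_closure_scaleR_image image_image)
  moreover have "simply_laced_root_lattice (K i)" for i
  proof (rule norm2_lattice.simply_laced, unfold_locales)
    show "K i = group_closure ((*\<^sub>R) (1 / sqrt (real (Suc i))) ` Ui i)" by (simp add: K_def)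
    show "finite ((*\<^sub>R) (1 / sqrt (real (Suc i))) ` Ui i)" using U(1) by (simp add: Ui_def)
    fix s assume s: "s \<in> (*\<^sub>R) (1 / sqrt (real (Suc i))) ` Ui i"
    then obtain u where u: "u \<in> Ui i" "s = (1 / sqrt (real (Suc i))) *\<^sub>R u" by blast
    then show "s \<bullet> s = 2" by (simp add: Ui_def field_simps)
    fix t assume t: "t \<in> (*\<^sub>R) (1 / sqrt (real (Suc i))) ` Ui i"
    then obtain v where v: "v \<in> Ui i" "t = (1 / sqrt (real (Suc i))) *\<^sub>R v" by blast
    have uv: "u \<in> U" "v \<in> U" "v \<bullet> v = 2 * real (Suc i)" using u(1) v(1) by (auto simp: Ui_def)
    \<comment> \<open>With p = \<open>Suc i\<close>, dilation by 1 / sqrt p turns the inner product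
      of two screeners of norm 2p into a Cartan integer, so its integrality is the screener
      condition for \<open>v\<close>.\<close>
    have "s \<bullet> t = 2 * (u \<bullet> v) / (v \<bullet> v)"
      unfolding uv(3) u(2) v(2) by (simp del: of_nat_Suc)
    also have "\<dots> \<in> \<int>" using screenersD(4)[OF scr[OF uv(2)]] screenersD(1)[OF scr[OF uv(1)]] .
    finally show "s \<bullet> t \<in> \<int>" .
  qed
  ultimately show ?thesis
    by (intro exI[of _ m] exI[of _ "\<lambda>i. Suc i"] exI[of _ K]) simp
qed

section \<open>Coordinates with respect to generators with a given Gram matrix\<close>

locale norm2_basis =
  fixes n :: nat and G :: "nat \<Rightarrow> nat \<Rightarrow> int" and b :: "nat \<Rightarrow> 'a::real_inner" and K :: "'a set"
  assumes lattice_basis: "K = group_closure (b ` {..<n})"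
    and gram: "i < n \<Longrightarrow> j < n \<Longrightarrow> b i \<bullet> b j = of_int (G i j)"
    and gram_diag: "i < n \<Longrightarrow> G i i = 2"
begin

sublocale norm2_lattice "b ` {..<n}" K
  by unfold_locales (auto simp: lattice_basis gram gram_diag)

lemma lattice_coords: "K = {\<Sum>i<n. of_int (c i) *\<^sub>R b i | c :: nat \<Rightarrow> int. True}"
  unfolding lattice_basis by (rule group_closure_image_eq)

lemma basis_in: "i < n \<Longrightarrow> b i \<in> K"
  unfolding lattice_basis by (auto intro: group_closure.base)

lemma inner_coords:
  "j < n \<Longrightarrow> b j \<bullet> (\<Sum>i<n. of_int (c i) *\<^sub>R b i) = of_int (\<Sum>i<n. c i * G i j)"
  by (simp add: inner_sum_right gram inner_commute[of "b j"])

lemma norm_coords: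
  "(\<Sum>i<n. of_int (c i) *\<^sub>R b i) \<bullet> (\<Sum>i<n. of_int (c i) *\<^sub>R b i)
     = of_int (\<Sum>j<n. c j * (\<Sum>i<n. c i * G i j))"
  by (subst inner_sum_left) (simp add: inner_coords)

text \<open>The integers \<open>k j\<close> are the inner products of \<open>x / p\<close> with the
  generators, so the sum of the \<open>c j * k j\<close> is the inner product of \<open>x\<close>
  and \<open>x / p\<close>, that is 2. If p divided all \<open>c j\<close>, it would divide this 2;
  then p would be 2 and \<open>x\<close> would lie in 2K.\<close>

lemma nonroot_screener_coords:
  assumes "x \<in> screeners K - roots K"
  obtains p :: int and c k :: "nat \<Rightarrow> int"
  where "p \<in> {2, 3}" "x = (\<Sum>i<n. of_int (c i) *\<^sub>R b i)"
    "\<And>j. j < n \<Longrightarrow> (\<Sum>i<n. c i * G i j) = p * k j"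
    "(\<Sum>j<n. c j * k j) = 2" "\<not> (\<forall>i<n. p dvd c i)"
proof -
  from assms obtain p :: int where p: "p \<in> {2, 3}" "x \<bullet> x = 2 * of_int p"
    and dvd: "\<And>y. y \<in> K \<Longrightarrow> \<exists>k::int. y \<bullet> x = of_int (p * k)"
    by (rule nonroot_screenerE) blast
  have "x \<in> K" using assms screenersD(1) by blast
  then obtain c :: "nat \<Rightarrow> int" where c: "x = (\<Sum>i<n. of_int (c i) *\<^sub>R b i)"
    using lattice_coords by blast
  have "\<exists>k. j < n \<longrightarrow> (\<Sum>i<n. c i * G i j) = p * k" for j
    using dvd[OF basis_in[of j]] inner_coords[of j c] c by (metis of_int_eq_iff)
  then obtain k where k: "\<And>j. j < n \<Longrightarrow> (\<Sum>i<n. c i * G i j) = p * k j" by metis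
  have "real_of_int (2 * p) = of_int (\<Sum>j<n. c j * (p * k j))"
    using p(2) norm_coords[of c] k c by simp
  then have "p * 2 = p * (\<Sum>j<n. c j * k j)"
    unfolding of_int_eq_iff by (simp add: sum_distrib_left mult_ac)
  then have norm: "(\<Sum>j<n. c j * k j) = 2" using p(1) by auto
  have "\<not> (\<forall>i<n. p dvd c i)"
  proof
    assume "\<forall>i<n. p dvd c i"
    then have "p dvd (\<Sum>j<n. c j * k j)" by (intro dvd_sum) auto
    then have "p = 2" using norm p(1) by auto
    have "\<forall>i. \<exists>d. i < n \<longrightarrow> c i = p * d" using \<open>\<forall>i<n. p dvd c i\<close> by (auto elim: dvdE)
    then obtain d where d: "\<And>i. i < n \<Longrightarrow> c i = p * d i" by metis
    then have "x = 2 *\<^sub>R (\<Sum>i<n. of_int (d i) *\<^sub>R b i)"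
      unfolding c scaleR_sum_right \<open>p = 2\<close> by (intro sum.cong) auto
    then have "x \<in> (*\<^sub>R) 2 ` K" unfolding lattice_coords by blast
    then show False using assms screenersD(2) by blast
  qed
  then show ?thesis using that p(1) c k norm by blast
qed

end

lemma root_lattice_of_typeE:
  assumes "root_lattice_of_type X K"
  obtains b where "norm2_basis (dynkin_rank X) (cartan_entry X) b K"
proof -
  from assms obtain b where b: "root_base (roots K) (dynkin_rank X) b"
    and cartan: "\<And>i j. i < dynkin_rank X \<Longrightarrow> j < dynkin_rank X \<Longrightarrow>
           2 * (b i \<bullet> b j) / (b j \<bullet> b j) = of_int (cartan_entry X i j)"
    and K: "K = group_closure (roots K)"
    unfolding root_lattice_of_type_def root_system_of_type_def by blast
  have br: "b i \<in> roots K" if "i < dynkin_rank X" for i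
    using b that by (auto simp: root_base_def)
  have "roots K \<subseteq> group_closure (b ` {..<dynkin_rank X})"
    using b by (subst group_closure_image_eq) (unfold root_base_def, blast)
  then have "K \<subseteq> group_closure (b ` {..<dynkin_rank X})"
    using K group_closure_subset by blast
  moreover have "group_closure (b ` {..<dynkin_rank X}) \<subseteq> K"
    using K group_closure_mono[of "b ` {..<dynkin_rank X}" "roots K"] br by auto
  ultimately have "K = group_closure (b ` {..<dynkin_rank X})" by blast
  moreover have "b i \<bullet> b j = of_int (cartan_entry X i j)"
    if "i < dynkin_rank X" "j < dynkin_rank X" for i j
    using cartan[OF that] br[OF that(2)] by (simp add: roots_def)
  moreover have "cartan_entry X i i = 2" for i by (simp add: cartan_entry_def)
  ultimately have "norm2_basis (dynkin_rank X) (cartan_entry X) b K"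
    by (simp add: norm2_basis_def)
  then show ?thesis by (rule that)
qed

lemma (in norm2_lattice) screeners_eq_roots:
  assumes "\<And>x. x \<in> screeners K - roots K \<Longrightarrow> False"
  shows "screeners K = roots K"
  using assms roots_subset_screeners by blast

section \<open>Exceptional types\<close>

text \<open>The determinant is 1: the inverse Cartan matrix is integral, so a number dividing all
  inner products \<open>m j\<close> divides all coordinates, for p = 2 and p = 3 alike.\<close>

lemma screeners_E8:
  assumes "root_lattice_of_type (TypeE 8) K"
  shows "screeners K = roots K"
proof -
  obtain b where "norm2_basis (dynkin_rank (TypeE 8)) (cartan_entry (TypeE 8)) b K"
    using assms by (rule root_lattice_of_typeE)
  then interpret norm2_basis 8 "cartan_entry (TypeE 8)" b K by simp
  show ?thesis
  proof (rule screeners_eq_roots)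
    fix x assume "x \<in> screeners K - roots K"
    then obtain p c k where p: "p \<in> {2, 3}"
      and k: "\<And>j. j < 8 \<Longrightarrow> (\<Sum>i<8. c i * cartan_entry (TypeE 8) i j) = p * k j"
      and ndvd: "\<not> (\<forall>i<8. p dvd c i)"
      by (rule nonroot_screener_coords) blast
    define m where "m j = p * k j" for j
    have m: "2 * c 0 - c 1 = m 0" "2 * c 1 - c 0 - c 2 = m 1" "2 * c 2 - c 1 - c 3 - c 7 = m 2"
      "2 * c 3 - c 2 - c 4 = m 3" "2 * c 4 - c 3 - c 5 = m 4" "2 * c 5 - c 4 - c 6 = m 5"
      "2 * c 6 - c 5 = m 6" "2 * c 7 - c 2 = m 7"
      using k[of 0] k[of 1] k[of 2] k[of 3] k[of 4] k[of 5] k[of 6] k[of 7]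
      by (simp_all add: m_def lessThan_nat_numeral cartan_entry_def)
    (* the coefficients are the entries of the inverse Cartan matrix *)
    have "c 0 = 4 * m 0 + 7 * m 1 + 10 * m 2 + 8 * m 3 + 6 * m 4 + 4 * m 5 + 2 * m 6 + 5 * m 7"
      "c 1 = 7 * m 0 + 14 * m 1 + 20 * m 2 + 16 * m 3 + 12 * m 4 + 8 * m 5 + 4 * m 6 + 10 * m 7"
      "c 2 = 10 * m 0 + 20 * m 1 + 30 * m 2 + 24 * m 3 + 18 * m 4 + 12 * m 5 + 6 * m 6 + 15 * m 7"
      "c 3 = 8 * m 0 + 16 * m 1 + 24 * m 2 + 20 * m 3 + 15 * m 4 + 10 * m 5 + 5 * m 6 + 12 * m 7"
      "c 4 = 6 * m 0 + 12 * m 1 + 18 * m 2 + 15 * m 3 + 12 * m 4 + 8 * m 5 + 4 * m 6 + 9 * m 7"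
      "c 5 = 4 * m 0 + 8 * m 1 + 12 * m 2 + 10 * m 3 + 8 * m 4 + 6 * m 5 + 3 * m 6 + 6 * m 7"
      "c 6 = 2 * m 0 + 4 * m 1 + 6 * m 2 + 5 * m 3 + 4 * m 4 + 3 * m 5 + 2 * m 6 + 3 * m 7"
      "c 7 = 5 * m 0 + 10 * m 1 + 15 * m 2 + 12 * m 3 + 9 * m 4 + 6 * m 5 + 3 * m 6 + 8 * m 7"
      using m by linarith+
    moreover have "p dvd m j" for j by (simp add: m_def)
    ultimately have "p dvd c 0" "p dvd c 1" "p dvd c 2" "p dvd c 3" "p dvd c 4" "p dvd c 5"
      "p dvd c 6" "p dvd c 7"
      by (simp_all only: dvd_add dvd_mult)
    then have "\<forall>i<8. p dvd c i" by (auto simp: less_Suc_eq numeral_eq_Suc)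
    then show False using ndvd by blast
  qed
qed

text \<open>The determinant is 2. For p = 3 the Cartan matrix is invertible modulo p and the
  argument is that of E_8; p = 2 would take a dual vector of norm 1, while the norms in the dual are
  0 or 3/2 modulo 2.\<close>

lemma screeners_E7:
  assumes "root_lattice_of_type (TypeE 7) K"
  shows "screeners K = roots K"
proof -
  obtain b where "norm2_basis (dynkin_rank (TypeE 7)) (cartan_entry (TypeE 7)) b K"
    using assms by (rule root_lattice_of_typeE)
  then interpret norm2_basis 7 "cartan_entry (TypeE 7)" b K by simp
  show ?thesis
  proof (rule screeners_eq_roots)
    fix x assume "x \<in> screeners K - roots K"
    then obtain p c k where p: "p \<in> {2, 3}"
      and k: "\<And>j. j < 7 \<Longrightarrow> (\<Sum>i<7. c i * cartan_entry (TypeE 7) i j) = p * k j"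
      and norm: "(\<Sum>j<7. c j * k j) = 2"
      and ndvd: "\<not> (\<forall>i<7. p dvd c i)"
      by (rule nonroot_screener_coords) blast
    define m where "m j = p * k j" for j
    have m: "2 * c 0 - c 1 = m 0" "2 * c 1 - c 0 - c 2 = m 1" "2 * c 2 - c 1 - c 3 - c 6 = m 2"
      "2 * c 3 - c 2 - c 4 = m 3" "2 * c 4 - c 3 - c 5 = m 4" "2 * c 5 - c 4 = m 5"
      "2 * c 6 - c 2 = m 6"
      using k[of 0] k[of 1] k[of 2] k[of 3] k[of 4] k[of 5] k[of 6]
      by (simp_all add: m_def lessThan_nat_numeral cartan_entry_def)
    (* the coefficients are twice the inverse Cartan matrix *)
    have c: "2 * c 0 = 4 * m 0 + 6 * m 1 + 8 * m 2 + 6 * m 3 + 4 * m 4 + 2 * m 5 + 4 * m 6"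
      "2 * c 1 = 6 * m 0 + 12 * m 1 + 16 * m 2 + 12 * m 3 + 8 * m 4 + 4 * m 5 + 8 * m 6"
      "2 * c 2 = 8 * m 0 + 16 * m 1 + 24 * m 2 + 18 * m 3 + 12 * m 4 + 6 * m 5 + 12 * m 6"
      "2 * c 3 = 6 * m 0 + 12 * m 1 + 18 * m 2 + 15 * m 3 + 10 * m 4 + 5 * m 5 + 9 * m 6"
      "2 * c 4 = 4 * m 0 + 8 * m 1 + 12 * m 2 + 10 * m 3 + 8 * m 4 + 4 * m 5 + 6 * m 6"
      "2 * c 5 = 2 * m 0 + 4 * m 1 + 6 * m 2 + 5 * m 3 + 4 * m 4 + 3 * m 5 + 3 * m 6"
      "2 * c 6 = 4 * m 0 + 8 * m 1 + 12 * m 2 + 9 * m 3 + 6 * m 4 + 3 * m 5 + 7 * m 6"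
      using m by linarith+
    show False
    proof (cases "p = 2")
      case False
      then have p: "p = 3" using p by simp
      have "3 dvd m j" for j by (simp add: m_def p)
      then have "3 dvd 2 * c 0" "3 dvd 2 * c 1" "3 dvd 2 * c 2" "3 dvd 2 * c 3" "3 dvd 2 * c 4"
        "3 dvd 2 * c 5" "3 dvd 2 * c 6"
        unfolding c by (simp_all only: dvd_add dvd_mult)
      then have "p dvd c 0" "p dvd c 1" "p dvd c 2" "p dvd c 3" "p dvd c 4" "p dvd c 5" "p dvd c 6"
        unfolding p by presburger+
      then have "\<forall>i<7. p dvd c i" by (auto simp: less_Suc_eq numeral_eq_Suc)
      then show False using ndvd by blast
    next
      case True
      (* 3 t^2 + 4 r is twice the norm of a vector of the dual lattice: vectors outside the lattice
         have norm 3/2 modulo 2, and t modulo 2 is the class in the discriminant group *)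
      define t where "t = k 3 + k 5 + k 6"
      define r where "r = k 0 * k 0 + 3 * k 0 * k 1 + 4 * k 0 * k 2 + 3 * k 0 * k 3 + 2 * k 0 * k 4 +
        k 0 * k 5 + 2 * k 0 * k 6 + 3 * k 1 * k 1 + 8 * k 1 * k 2 + 6 * k 1 * k 3 + 4 * k 1 * k 4 +
        2 * k 1 * k 5 + 4 * k 1 * k 6 + 6 * k 2 * k 2 + 9 * k 2 * k 3 + 6 * k 2 * k 4 +
        3 * k 2 * k 5 + 6 * k 2 * k 6 + 3 * k 3 * k 3 + 5 * k 3 * k 4 + k 3 * k 5 + 3 * k 3 * k 6 +
        2 * k 4 * k 4 + 2 * k 4 * k 5 + 3 * k 4 * k 6 + k 6 * k 6"
      have ck: "c 0 = 4 * k 0 + 6 * k 1 + 8 * k 2 + 6 * k 3 + 4 * k 4 + 2 * k 5 + 4 * k 6"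
        "c 1 = 6 * k 0 + 12 * k 1 + 16 * k 2 + 12 * k 3 + 8 * k 4 + 4 * k 5 + 8 * k 6"
        "c 2 = 8 * k 0 + 16 * k 1 + 24 * k 2 + 18 * k 3 + 12 * k 4 + 6 * k 5 + 12 * k 6"
        "c 3 = 6 * k 0 + 12 * k 1 + 18 * k 2 + 15 * k 3 + 10 * k 4 + 5 * k 5 + 9 * k 6"
        "c 4 = 4 * k 0 + 8 * k 1 + 12 * k 2 + 10 * k 3 + 8 * k 4 + 4 * k 5 + 6 * k 6"
        "c 5 = 2 * k 0 + 4 * k 1 + 6 * k 2 + 5 * k 3 + 4 * k 4 + 3 * k 5 + 3 * k 6"
        "c 6 = 4 * k 0 + 8 * k 1 + 12 * k 2 + 9 * k 3 + 6 * k 4 + 3 * k 5 + 7 * k 6"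
        using c by (simp_all add: m_def True)
      have "(\<Sum>j<7. c j * k j) = 3 * (t * t) + 4 * r"
        by (simp add: lessThan_nat_numeral) (simp add: ck[unfolded One_nat_def] t_def r_def algebra_simps)
      then have eq: "3 * (t * t) + 4 * r = 2" using norm by simp
      \<comment> \<open>The square is replaced by a variable \<open>q\<close> to make the statement
        linear. An even square makes \<open>t\<close> even, and then 4 would divide 2.\<close>
      have "even q" if "3 * q + 4 * r = 2" for q using that by presburger
      then have "even (t * t)" using eq .
      then obtain u where "t = 2 * u" by auto
      then have "12 * (u * u) + 4 * r = 2" using eq by simp
      then show False by presburger
    qed
  qed
qed

text \<open>The determinant is 3, so the primes exchange roles: p = 2 is excluded as for E_8, and p
  = 3 would take a dual vector of norm 2/3, while the norms in the dual are 0 or 4/3 modulo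
  2.\<close>

lemma screeners_E6:
  assumes "root_lattice_of_type (TypeE 6) K"
  shows "screeners K = roots K"
proof -
  obtain b where "norm2_basis (dynkin_rank (TypeE 6)) (cartan_entry (TypeE 6)) b K"
    using assms by (rule root_lattice_of_typeE)
  then interpret norm2_basis 6 "cartan_entry (TypeE 6)" b K by simp
  show ?thesis
  proof (rule screeners_eq_roots)
    fix x assume "x \<in> screeners K - roots K"
    then obtain p c k where p: "p \<in> {2, 3}"
      and k: "\<And>j. j < 6 \<Longrightarrow> (\<Sum>i<6. c i * cartan_entry (TypeE 6) i j) = p * k j"
      and norm: "(\<Sum>j<6. c j * k j) = 2"
      and ndvd: "\<not> (\<forall>i<6. p dvd c i)"
      by (rule nonroot_screener_coords) blast
    define m where "m j = p * k j" for j
    have m: "2 * c 0 - c 1 = m 0" "2 * c 1 - c 0 - c 2 = m 1" "2 * c 2 - c 1 - c 3 - c 5 = m 2"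
      "2 * c 3 - c 2 - c 4 = m 3" "2 * c 4 - c 3 = m 4" "2 * c 5 - c 2 = m 5"
      using k[of 0] k[of 1] k[of 2] k[of 3] k[of 4] k[of 5]
      by (simp_all add: m_def lessThan_nat_numeral cartan_entry_def)
    (* the coefficients are three times the inverse Cartan matrix *)
    have c: "3 * c 0 = 4 * m 0 + 5 * m 1 + 6 * m 2 + 4 * m 3 + 2 * m 4 + 3 * m 5"
      "3 * c 1 = 5 * m 0 + 10 * m 1 + 12 * m 2 + 8 * m 3 + 4 * m 4 + 6 * m 5"
      "3 * c 2 = 6 * m 0 + 12 * m 1 + 18 * m 2 + 12 * m 3 + 6 * m 4 + 9 * m 5"
      "3 * c 3 = 4 * m 0 + 8 * m 1 + 12 * m 2 + 10 * m 3 + 5 * m 4 + 6 * m 5"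
      "3 * c 4 = 2 * m 0 + 4 * m 1 + 6 * m 2 + 5 * m 3 + 4 * m 4 + 3 * m 5"
      "3 * c 5 = 3 * m 0 + 6 * m 1 + 9 * m 2 + 6 * m 3 + 3 * m 4 + 6 * m 5"
      using m by linarith+
    show False
    proof (cases "p = 3")
      case False
      then have p: "p = 2" using p by simp
      have "2 dvd m j" for j by (simp add: m_def p)
      then have "2 dvd 3 * c 0" "2 dvd 3 * c 1" "2 dvd 3 * c 2" "2 dvd 3 * c 3" "2 dvd 3 * c 4"
        "2 dvd 3 * c 5"
        unfolding c by (simp_all only: dvd_add dvd_mult)
      then have "p dvd c 0" "p dvd c 1" "p dvd c 2" "p dvd c 3" "p dvd c 4" "p dvd c 5"
        unfolding p by presburger+
      then have "\<forall>i<6. p dvd c i" by (auto simp: less_Suc_eq numeral_eq_Suc)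
      then show False using ndvd by blast
    next
      case True
      (* 4 t^2 + 6 r is three times the norm of a vector of the dual lattice: vectors outside the
         lattice have norm 4/3 modulo 2, and t modulo 3 is the class in the discriminant group *)
      define t where "t = k 0 - k 1 + k 3 - k 4"
      define r where "r = 3 * k 0 * k 1 + 2 * k 0 * k 2 + 2 * k 0 * k 4 + k 0 * k 5 + k 1 * k 1 +
        4 * k 1 * k 2 + 4 * k 1 * k 3 + 2 * k 1 * k 5 + 3 * k 2 * k 2 + 4 * k 2 * k 3 +
        2 * k 2 * k 4 + 3 * k 2 * k 5 + k 3 * k 3 + 3 * k 3 * k 4 + 2 * k 3 * k 5 + k 4 * k 5 +
        k 5 * k 5"
      have ck: "c 0 = 4 * k 0 + 5 * k 1 + 6 * k 2 + 4 * k 3 + 2 * k 4 + 3 * k 5"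
        "c 1 = 5 * k 0 + 10 * k 1 + 12 * k 2 + 8 * k 3 + 4 * k 4 + 6 * k 5"
        "c 2 = 6 * k 0 + 12 * k 1 + 18 * k 2 + 12 * k 3 + 6 * k 4 + 9 * k 5"
        "c 3 = 4 * k 0 + 8 * k 1 + 12 * k 2 + 10 * k 3 + 5 * k 4 + 6 * k 5"
        "c 4 = 2 * k 0 + 4 * k 1 + 6 * k 2 + 5 * k 3 + 4 * k 4 + 3 * k 5"
        "c 5 = 3 * k 0 + 6 * k 1 + 9 * k 2 + 6 * k 3 + 3 * k 4 + 6 * k 5"
        using c by (simp_all add: m_def True)
      have "(\<Sum>j<6. c j * k j) = 4 * (t * t) + 6 * r"
        by (simp add: lessThan_nat_numeral) (simp add: ck[unfolded One_nat_def] t_def r_def algebra_simps)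
      then have eq: "4 * (t * t) + 6 * r = 2" using norm by simp
      have "(\<exists>u. t = 3 * u) \<or> (\<exists>u. t = 3 * u + 1) \<or> (\<exists>u. t = 3 * u + 2)" by presburger
      then consider u where "t = 3 * u" | u where "t = 3 * u + 1" | u where "t = 3 * u + 2"
        by blast
      then show False
      proof cases
        case 1
        then have "36 * (u * u) + 6 * r = 2" using eq by (simp add: algebra_simps)
        then show False by presburger
      next
        case 2
        then have "36 * (u * u) + 24 * u + 4 + 6 * r = 2" using eq by (simp add: algebra_simps)
        then show False by presburger
      next
        case 3
        then have "36 * (u * u) + 48 * u + 16 + 6 * r = 2" using eq by (simp add: algebra_simps)
        then show False by presburger
      qed
    qed
  qed
qed

section \<open>Type \<open>A\<^sub>n\<close>\<close>

text \<open>Summation by parts, expressing the norm in \<open>A\<^sub>N\<close> by the coordinates of \<open>\<int>\<^sup>N\<^sup>+\<^sup>1\<close>.\<close>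
lemma chain_norm:
  fixes d :: "nat \<Rightarrow> int"
  assumes "d 0 = 0"
  shows "(\<Sum>j<N. d (Suc j) * (2 * d (Suc j) - d j - d (Suc (Suc j))))
     = (\<Sum>j<N. (d (Suc j) - d j)\<^sup>2) - d N * (d (Suc N) - d N)"
  using assms by (induction N) (auto simp: power2_eq_square algebra_simps)

text \<open>Shifting the coordinates by one and padding them with a zero at both ends lets the end
  nodes of the chain obey the same three-term formula as the inner ones.\<close>

lemma chain_inner:
  fixes d :: "nat \<Rightarrow> int"
  assumes "d 0 = 0" "d (Suc n) = 0" "j < n"
  shows "(\<Sum>i<n. d (Suc i) * cartan_entry (TypeA n) i j) = 2 * d (Suc j) - d j - d (Suc (Suc j))"
proof -
  have "(\<Sum>i<n. d (Suc i) * cartan_entry (TypeA n) i j)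
      = (\<Sum>i<n. (if i = j then 2 * d (Suc i) else 0) - (if Suc i = j then d (Suc i) else 0)
          - (if i = Suc j then d (Suc i) else 0))"
    by (intro sum.cong) (auto simp: cartan_entry_def)
  also have "\<dots> = (\<Sum>i<n. if i = j then 2 * d (Suc i) else 0)
      - (\<Sum>i<n. if Suc i = j then d (Suc i) else 0) - (\<Sum>i<n. if i = Suc j then d (Suc i) else 0)"
    by (simp only: sum_subtractf)
  also have "(\<Sum>i<n. if i = j then 2 * d (Suc i) else 0) = 2 * d (Suc j)"
    using assms(3) by simp
  also have "(\<Sum>i<n. if Suc i = j then d (Suc i) else 0) = d j"
  proof (cases j)
    case 0
    then show ?thesis using assms(1) by simp
  next
    case (Suc l)
    then show ?thesis using assms(3) by simp
  qed
  also have "(\<Sum>i<n. if i = Suc j then d (Suc i) else 0) = d (Suc (Suc j))"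
  proof (cases "Suc j < n")
    case False
    then have "Suc j = n" using assms(3) by simp
    then show ?thesis using assms(2) by simp
  qed simp
  finally show ?thesis .
qed

text \<open>In the model of A_n by integer vectors of length n + 1 with sum zero, the coordinates
  \<open>y j\<close> of \<open>x\<close> are congruent modulo p, not divisible by p, and have square
  sum 2p. For p = 2 each square is at least 1, so n + 1 is at most 4; for p = 3 the squares add up
  to at least 2(n + 1), so n + 1 is at most 3. The equality cases are the exceptions A_3 and
  A_2.\<close>

lemma screeners_A:
  assumes "root_lattice_of_type (TypeA n) K" "n > 3"
  shows "screeners K = roots K"
proof -
  obtain b where "norm2_basis (dynkin_rank (TypeA n)) (cartan_entry (TypeA n)) b K"
    using assms(1) by (rule root_lattice_of_typeE)
  then interpret norm2_basis n "cartan_entry (TypeA n)" b K by simp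
  show ?thesis
  proof (rule screeners_eq_roots)
    fix x assume "x \<in> screeners K - roots K"
    then obtain p c k where p: "p \<in> {2, 3}"
      and k: "\<And>j. j < n \<Longrightarrow> (\<Sum>i<n. c i * cartan_entry (TypeA n) i j) = p * k j"
      and norm: "(\<Sum>j<n. c j * k j) = 2"
      and ndvd: "\<not> (\<forall>i<n. p dvd c i)"
      by (rule nonroot_screener_coords) blast
    define d where "d j = (if j = 0 \<or> j > n then 0 else c (j - 1))" for j
    have d: "d 0 = 0" "d (Suc n) = 0" "\<And>i. i < n \<Longrightarrow> d (Suc i) = c i" by (auto simp: d_def)
    define y where "y j = d (Suc j) - d j" for j
    have pk: "y j - y (Suc j) = p * k j" if "j < n" for j
      using chain_inner[of d n j] d(1,2) that k[OF that] d(3) by (simp add: y_def)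
    have "p * 2 = (\<Sum>j<n. d (Suc j) * (p * k j))"
      using norm d(3) by (simp add: sum_distrib_left mult_ac flip: norm)
    also have "\<dots> = (\<Sum>j<n. d (Suc j) * (2 * d (Suc j) - d j - d (Suc (Suc j))))"
      by (intro sum.cong) (auto simp: y_def simp flip: pk)
    also have "\<dots> = (\<Sum>j<Suc n. (y j)\<^sup>2)"
      using chain_norm[of d n] d(1) d(2) by (simp add: y_def power2_eq_square)
    finally have sq: "(\<Sum>j<Suc n. (y j)\<^sup>2) = 2 * p" by simp
    have sum0: "(\<Sum>j<Suc n. y j) = 0"
      unfolding y_def by (subst sum_lessThan_telescope) (simp add: d)
    have cong: "p dvd y j - y 0" if "j \<le> n" for j
      using that
    proof (induction j)
      case (Suc j)
      then have "p dvd y j - y 0" "p dvd y j - y (Suc j)" using pk[of j] by simp_all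
      then have "p dvd (y j - y 0) - (y j - y (Suc j))" by (rule dvd_diff)
      then show ?case by simp
    qed simp
    \<comment> \<open>Otherwise p would divide every \<open>y j\<close> and hence, starting from
      \<open>d 0 = 0\<close>, all coordinates of \<open>x\<close>.\<close>
    have y0: "\<not> p dvd y 0"
    proof
      assume *: "p dvd y 0"
      have "j \<le> Suc n \<Longrightarrow> p dvd d j" for j
      proof (induction j)
        case (Suc j)
        then have "p dvd d j" "p dvd y j - y 0" using cong[of j] by simp_all
        then have "p dvd d j + (y j - y 0) + y 0" using * by (simp only: dvd_add)
        then show ?case by (simp add: y_def)
      qed (simp add: d)
      then have "p dvd c i" if "i < n" for i using d(3)[OF that] that by (metis Suc_leI le_Suc_eq)
      then show False using ndvd by blast
    qed
    show False
    proof (cases "p = 2")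
      case True
      have "(y j)\<^sup>2 \<ge> 1" if "j \<in> {..<Suc n}" for j
      proof -
        have "y j \<noteq> 0" using cong[of j] y0 that True by auto
        then show ?thesis by (simp add: int_one_le_iff_zero_less)
      qed
      then have "(\<Sum>j<Suc n. 1) \<le> (\<Sum>j<Suc n. (y j)\<^sup>2)" by (rule sum_mono)
      then show False using sq True assms(2) by simp
    next
      case False
      then have p3: "p = 3" using p by simp
      obtain s :: int where s: "s = 1 \<or> s = -1" "3 dvd s * y 0 - 1"
      proof (cases "3 dvd y 0 - 1")
        case False
        then have "3 dvd - 1 * y 0 - 1" using y0 p3 by presburger
        then show ?thesis using that by blast
      qed (use that[of 1] in simp)
      (* up to sign all y j are 1 modulo 3, so that (y j + 2) * (y j - 1) is nonnegative *)
      have "(y j)\<^sup>2 \<ge> 2 - s * y j" if "j \<in> {..<Suc n}" for j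
      proof -
        have "3 dvd s * (y j - y 0)" using cong[of j] that p3 by simp
        then have "3 dvd s * (y j - y 0) + (s * y 0 - 1)" using s(2) by (rule dvd_add)
        then have "3 dvd s * y j - 1" by (simp add: algebra_simps)
        then have "s * y j \<le> -2 \<or> s * y j \<ge> 1" by presburger
        then have "(s * y j + 2) * (s * y j - 1) \<ge> 0"
          by (auto intro: mult_nonneg_nonneg mult_nonpos_nonpos)
        moreover have "(s * y j)\<^sup>2 = (y j)\<^sup>2" using s(1) by auto
        moreover have "(s * y j + 2) * (s * y j - 1) = (s * y j)\<^sup>2 + s * y j - 2"
          by (simp add: power2_eq_square algebra_simps)
        ultimately show ?thesis by linarith
      qed
      then have "(\<Sum>j<Suc n. 2 - s * y j) \<le> (\<Sum>j<Suc n. (y j)\<^sup>2)" by (rule sum_mono)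
      \<comment> \<open>The linear terms add up to zero by \<open>sum0\<close>, which leaves 2(n +
        1) \<le> 2p = 6.\<close>
      also have "(\<Sum>j<Suc n. 2 - s * y j) = 2 * int (Suc n) - s * (\<Sum>j<Suc n. y j)"
        by (simp only: sum_subtractf sum_distrib_left) simp
      finally show False using sq sum0 p3 assms(2) by simp
    qed
  qed
qed

section \<open>Criteria for a base of a root system\<close>

lemma dual_vectors_independent:
  fixes g d :: "nat \<Rightarrow> 'a::real_inner"
  assumes dual: "\<And>i k. i < n \<Longrightarrow> k < n \<Longrightarrow> d k \<bullet> g i = 0 \<longleftrightarrow> i \<noteq> k"
  shows "inj_on g {..<n}" "independent (g ` {..<n})"
proof -
  show inj: "inj_on g {..<n}"
    using dual by (intro inj_onI) (metis lessThan_iff)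
  show "independent (g ` {..<n})"
  proof (rule independent_if_scalars_zero)
    fix f x assume sum: "(\<Sum>x\<in>g ` {..<n}. f x *\<^sub>R x) = 0" and "x \<in> g ` {..<n}"
    then obtain k where k: "k < n" "x = g k" by blast
    have "(\<Sum>i<n. f (g i) *\<^sub>R g i) = 0" using sum inj by (simp add: sum.reindex)
    then have "0 = d k \<bullet> (\<Sum>i<n. f (g i) *\<^sub>R g i)" by simp
    also have "\<dots> = (\<Sum>i<n. if i = k then f (g i) * (d k \<bullet> g i) else 0)"
      unfolding inner_sum_right using dual[OF _ k(1)] by (intro sum.cong) auto
    also have "\<dots> = f (g k) * (d k \<bullet> g k)" using k by simp
    finally show "f x = 0" using dual[OF k(1) k(1)] k(2) by simp
  qed simp
qed

text \<open>The vectors \<open>d k\<close> form a dual family up to nonzero factors, so they can be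
  chosen without denominators. Pairing with them isolates single coefficients and thereby gives
  independence.\<close>

lemma root_baseI:
  assumes "\<And>i k. i < n \<Longrightarrow> k < n \<Longrightarrow> d k \<bullet> g i = 0 \<longleftrightarrow> i \<noteq> k"
    and "\<And>i. i < n \<Longrightarrow> g i \<in> R"
    and "\<And>a. a \<in> R \<Longrightarrow> \<exists>c::nat \<Rightarrow> int. a = (\<Sum>i<n. of_int (c i) *\<^sub>R g i) \<and>
        ((\<forall>i<n. c i \<ge> 0) \<or> (\<forall>i<n. c i \<le> 0))"
  shows "root_base R n g"
  unfolding root_base_def using dual_vectors_independent[of n d g] assms by auto

text \<open>In a base of differences \<open>e i - e (i + 1)\<close> the coefficients of a vector are
  the partial sums of its coordinates. If two partial sums had opposite signs, reaching the first of
  them would use up at least 1 of the sum of absolute values, and passing to the other at least 2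
  more.\<close>

lemma partial_sums_same_sign:
  fixes x :: "nat \<Rightarrow> int"
  assumes le2: "(\<Sum>i<n. \<bar>x i\<bar>) \<le> 2"
  shows "(\<forall>k<n. (\<Sum>i\<le>k. x i) \<ge> 0) \<or> (\<forall>k<n. (\<Sum>i\<le>k. x i) \<le> 0)"
proof (rule ccontr)
  define s where "s k = (\<Sum>i\<le>k. x i)" for k
  assume "\<not> ?thesis"
  then obtain k l where kl: "k < n" "l < n" "s k < 0" "s l > 0" by (auto simp: s_def not_le)
  have *: "\<bar>s k\<bar> + \<bar>s l - s k\<bar> \<le> 2" if "k < l" "l < n" for k l
  proof -
    have un: "{..l} = {..k} \<union> {k<..l}" using that by auto
    have "s l = s k + (\<Sum>i\<in>{k<..l}. x i)"
      unfolding s_def un by (subst sum.union_disjoint) auto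
    then have "\<bar>s k\<bar> + \<bar>s l - s k\<bar> \<le> (\<Sum>i\<le>k. \<bar>x i\<bar>) + (\<Sum>i\<in>{k<..l}. \<bar>x i\<bar>)"
      by (simp add: s_def add_mono sum_abs)
    also have "\<dots> = (\<Sum>i\<le>l. \<bar>x i\<bar>)"
      unfolding un by (subst sum.union_disjoint) auto
    also have "\<dots> \<le> (\<Sum>i<n. \<bar>x i\<bar>)" using that by (intro sum_mono2) auto
    finally show ?thesis using le2 by linarith
  qed
  have "k \<noteq> l" using kl by auto
  then show False using *[of k l] *[of l k] kl by (cases "k < l") auto
qed

lemma sum_abs_le_sum_squares: "(\<Sum>i\<in>I. \<bar>x i\<bar>) \<le> (\<Sum>i\<in>I. (x i)\<^sup>2)" for x :: "'b \<Rightarrow> int"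
proof (rule sum_mono)
  fix i
  have "\<bar>x i\<bar> \<le> \<bar>x i\<bar>\<^sup>2"
    using self_le_power[of "\<bar>x i\<bar>" 2] by (cases "x i = 0") auto
  then show "\<bar>x i\<bar> \<le> (x i)\<^sup>2" by simp
qed

section \<open>Bases of type \<open>B\<^sub>n\<close> and \<open>C\<^sub>n\<close>\<close>

locale orthogonal_frame =
  fixes n :: nat and q :: real and e :: "nat \<Rightarrow> 'a::real_inner"
  assumes rank: "n \<ge> 2" and q_pos: "q > 0"
    and frame: "i < n \<Longrightarrow> j < n \<Longrightarrow> e i \<bullet> e j = (if i = j then q else 0)"
begin

text \<open>The two types share all but the last simple root: \<open>t = 1\<close> gives the short
  end of B_n, \<open>t = 2\<close> the long end of C_n. The frame has \<open>q = 2\<close> for a sum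
  of copies of A_1 and \<open>q = 1\<close> for D_n.\<close>

definition simple_root :: "int \<Rightarrow> nat \<Rightarrow> 'a" where
  "simple_root t i = (if Suc i = n then of_int t *\<^sub>R e i else e i - e (Suc i))"

lemma frame_inner: "j < n \<Longrightarrow> e j \<bullet> (\<Sum>i<n. of_int (x i) *\<^sub>R e i) = q * of_int (x j)"
proof -
  assume j: "j < n"
  have "e j \<bullet> (\<Sum>i<n. of_int (x i) *\<^sub>R e i) = (\<Sum>i<n. if i = j then q * of_int (x i) else 0)"
    unfolding inner_sum_right using j by (intro sum.cong) (auto simp: frame)
  then show ?thesis using j by simp
qed

lemma frame_inner_sum:
  "(\<Sum>i<n. of_int (x i) *\<^sub>R e i) \<bullet> (\<Sum>i<n. of_int (y i) *\<^sub>R e i) = q * of_int (\<Sum>i<n. x i * y i)"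
  by (subst inner_sum_left) (simp add: frame_inner sum_distrib_left mult_ac)

lemma partial_sum_coords:
  "(\<Sum>i<N. of_int (\<Sum>j\<le>i. x j) *\<^sub>R (e i - e (Suc i)))
     = (\<Sum>i\<le>N. of_int (x i) *\<^sub>R e i) - of_int (\<Sum>j\<le>N. x j) *\<^sub>R e N"
  by (induction N) (simp_all add: algebra_simps)

lemma root_base_simple_root:
  assumes t: "t \<in> {1, 2}" and R: "\<And>i. i < n \<Longrightarrow> simple_root t i \<in> R"
    and coords: "\<And>a. a \<in> R \<Longrightarrow> \<exists>x::nat \<Rightarrow> int. a = (\<Sum>i<n. of_int (x i) *\<^sub>R e i) \<and>
      (\<Sum>i<n. \<bar>x i\<bar>) \<le> 2 \<and> t dvd (\<Sum>i<n. x i)"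
  shows "root_base R n (simple_root t)"
proof (rule root_baseI)
  \<comment> \<open>Up to scale these are the fundamental weights: \<open>d k\<close> meets only the
    simple root with index \<open>k\<close>.\<close>
  define d where "d k = (\<Sum>i\<le>k. e i)" for k
  have de: "d k \<bullet> e i = (if i \<le> k then q else 0)" if "i < n" "k < n" for i k
  proof -
    have "d k \<bullet> e i = (\<Sum>j\<le>k. if j = i then q else 0)"
      unfolding d_def inner_sum_left using that by (intro sum.cong) (auto simp: frame)
    then show ?thesis by simp
  qed
  show "d k \<bullet> simple_root t i = 0 \<longleftrightarrow> i \<noteq> k" if "i < n" "k < n" for i k
    using that t q_pos by (auto simp: simple_root_def de inner_diff_right)
  show "simple_root t i \<in> R" if "i < n" for i using R that .
  fix a assume "a \<in> R"
  then obtain x :: "nat \<Rightarrow> int" where x: "a = (\<Sum>i<n. of_int (x i) *\<^sub>R e i)"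
    "(\<Sum>i<n. \<bar>x i\<bar>) \<le> 2" "t dvd (\<Sum>i<n. x i)"
    using coords by blast
  define s where "s k = (\<Sum>i\<le>k. x i)" for k
  obtain N where N: "n = Suc N" using rank by (cases n) auto
  have "t dvd s N" using x(3) by (simp add: N s_def lessThan_Suc_atMost)
  \<comment> \<open>The last simple root is \<open>t\<close> times a frame vector, so the last
    partial sum is divided by \<open>t\<close>; the division is exact because \<open>t\<close>
    divides the coordinate sum.\<close>
  define c where "c i = (if i = N then s N div t else s i)" for i
  have "simple_root t N = of_int t *\<^sub>R e N" "\<And>i. i < N \<Longrightarrow> simple_root t i = e i - e (Suc i)"
    unfolding simple_root_def by (auto simp: N)
  then have "(\<Sum>i<Suc N. of_int (c i) *\<^sub>R simple_root t i)
      = (\<Sum>i<N. of_int (s i) *\<^sub>R (e i - e (Suc i))) + of_int (s N div t * t) *\<^sub>R e N"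
    by (simp add: c_def)
  also have "s N div t * t = s N" using \<open>t dvd s N\<close> by simp
  also have "(\<Sum>i<N. of_int (s i) *\<^sub>R (e i - e (Suc i))) + of_int (s N) *\<^sub>R e N
      = (\<Sum>i<Suc N. of_int (x i) *\<^sub>R e i)"
    unfolding s_def partial_sum_coords by (simp add: lessThan_Suc_atMost)
  finally have "a = (\<Sum>i<n. of_int (c i) *\<^sub>R simple_root t i)"
    unfolding x(1) by (simp only: N[symmetric])
  moreover have "(\<forall>i<n. c i \<ge> 0) \<or> (\<forall>i<n. c i \<le> 0)"
    using partial_sums_same_sign[OF x(2)]
  proof
    assume "\<forall>k<n. (\<Sum>i\<le>k. x i) \<ge> 0"
    then have "\<forall>i<n. c i \<ge> 0"
      using t by (auto simp: c_def N pos_imp_zdiv_nonneg_iff simp flip: s_def)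
    then show ?thesis ..
  next
    assume "\<forall>k<n. (\<Sum>i\<le>k. x i) \<le> 0"
    then have "\<forall>i<n. s i \<le> 0" by (simp add: s_def)
    moreover have "s N div t \<le> 0" if "s N \<le> 0"
      using that t \<open>t dvd s N\<close> by (auto elim!: dvdE)
    ultimately have "\<forall>i<n. c i \<le> 0" by (auto simp: c_def N)
    then show ?thesis ..
  qed
  ultimately show "\<exists>c::nat \<Rightarrow> int. a = (\<Sum>i<n. of_int (c i) *\<^sub>R simple_root t i) \<and>
        ((\<forall>i<n. c i \<ge> 0) \<or> (\<forall>i<n. c i \<le> 0))" by blast
qed

lemma cartan_simple_root_B:
  assumes "i < n" "j < n"
  shows "2 * (simple_root 1 i \<bullet> simple_root 1 j) / (simple_root 1 j \<bullet> simple_root 1 j)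
    = of_int (cartan_entry (TypeB n) i j)"
  using assms rank q_pos
  by (auto simp: simple_root_def cartan_entry_def inner_diff_left inner_diff_right frame)

lemma cartan_simple_root_C:
  assumes "i < n" "j < n"
  shows "2 * (simple_root 2 i \<bullet> simple_root 2 j) / (simple_root 2 j \<bullet> simple_root 2 j)
    = of_int (cartan_entry (TypeC n) i j)"
  using assms rank q_pos
  by (auto simp: simple_root_def cartan_entry_def inner_diff_left inner_diff_right frame)

end

section \<open>Sums of copies of \<open>A\<^sub>1\<close>\<close>

text \<open>In the frame of generators of norm 2, a screener that is not a root satisfies
  \<open>2 * c j = p * k j\<close>. For p = 3 this would make 3 divide all coordinates; for p = 2 it
  leaves vectors of square sum 2. So the generators are the short roots up to sign, their sums and
  differences in pairs the long ones, which is the pattern of B_n.\<close>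

lemma screeners_sum_A1:
  assumes n: "n \<ge> 2" and M: "\<And>i. i < n \<Longrightarrow> root_lattice_of_type (TypeA 1) (M i)"
    and K: "orthogonal_direct_sum K n M"
  shows "root_system_of_type (TypeB n) (span K) (screeners K)"
proof -
  have "\<exists>a. M i = group_closure {a} \<and> a \<bullet> a = 2" if "i < n" for i
  proof -
    have Mi: "root_lattice_of_type (TypeA 1) (M i)" using M that .
    obtain b where "norm2_basis (dynkin_rank (TypeA 1)) (cartan_entry (TypeA 1)) b (M i)"
      using Mi by (rule root_lattice_of_typeE)
    then interpret norm2_basis 1 "cartan_entry (TypeA 1)" b "M i" by simp
    show ?thesis using lattice_basis gram[of 0 0] gram_diag[of 0] by (auto simp: lessThan_Suc)
  qed
  then obtain a where a: "\<And>i. i < n \<Longrightarrow> M i = group_closure {a i}" "\<And>i. i < n \<Longrightarrow> a i \<bullet> a i = 2"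
    by metis
  have aM: "a i \<in> M i" if "i < n" for i using a(1)[OF that] by (auto intro: group_closure.base)
  have orth: "a i \<bullet> a j = 0" if "i < n" "j < n" "i \<noteq> j" for i j
    using K aM that unfolding orthogonal_direct_sum_def by blast
  have "orthogonal_direct_sum (group_closure (\<Union>i<n. {a i})) n (\<lambda>i. group_closure {a i})"
    using orth by (intro orthogonal_direct_sum_group_closure) auto
  then have "K = group_closure (\<Union>i<n. {a i})"
    using K a(1) unfolding orthogonal_direct_sum_def by (auto cong: conj_cong)
  also have "(\<Union>i<n. {a i}) = a ` {..<n}" by blast
  finally interpret norm2_basis n "\<lambda>i j. if i = j then 2 else 0" a K
    using a(2) orth by unfold_locales auto
  interpret orthogonal_frame n 2 a using n a(2) orth by unfold_locales auto
  have sq: "\<exists>x::nat \<Rightarrow> int. v = (\<Sum>i<n. of_int (x i) *\<^sub>R a i) \<and> (\<Sum>i<n. \<bar>x i\<bar>) \<le> 2"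
    if v: "v \<in> screeners K" for v
  proof (cases "v \<in> roots K")
    case True
    then obtain x :: "nat \<Rightarrow> int" where x: "v = (\<Sum>i<n. of_int (x i) *\<^sub>R a i)"
      using lattice_coords by (auto simp: roots_def)
    have "real_of_int 1 = of_int (\<Sum>i<n. x i * x i)"
      using True x frame_inner_sum[of x x] by (simp add: roots_def)
    then have "(\<Sum>i<n. (x i)\<^sup>2) = 1" unfolding of_int_eq_iff by (simp add: power2_eq_square)
    then show ?thesis using x sum_abs_le_sum_squares[of x "{..<n}"] by auto
  next
    case False
    with v have "v \<in> screeners K - roots K" by blast
    then obtain p c k where p: "p \<in> {2, 3}" and x: "v = (\<Sum>i<n. of_int (c i) *\<^sub>R a i)"
      and k: "\<And>j. j < n \<Longrightarrow> (\<Sum>i<n. c i * (if i = j then 2 else 0)) = p * k j"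
      and norm: "(\<Sum>j<n. c j * k j) = 2" and ndvd: "\<not> (\<forall>i<n. p dvd c i)"
      by (rule nonroot_screener_coords) blast
    have k: "2 * c j = p * k j" if "j < n" for j
    proof -
      have "(\<Sum>i<n. c i * (if i = j then 2 else 0)) = (\<Sum>i<n. if i = j then 2 * c i else 0)"
        by (intro sum.cong) auto
      then show ?thesis using k[OF that] that by simp
    qed
    have "p = 2"
    proof (rule ccontr)
      assume "p \<noteq> 2"
      then have p3: "p = 3" using p by simp
      have "p dvd c i" if "i < n" for i using k[OF that] unfolding p3 by presburger
      then show False using ndvd by blast
    qed
    then have "c j = k j" if "j < n" for j using k[OF that] by simp
    then have "(\<Sum>i<n. (c i)\<^sup>2) = 2" using norm by (simp add: power2_eq_square)
    then show ?thesis using x sum_abs_le_sum_squares[of c "{..<n}"] by auto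
  qed
  have simple: "simple_root 1 i \<in> screeners K" if i: "i < n" for i
  proof (cases "Suc i = n")
    case True
    then show ?thesis
      using roots_subset_screeners basis_in[OF i] a(2)[OF i] by (auto simp: simple_root_def roots_def)
  next
    case False
    then have i': "Suc i < n" using i by simp
    have "a i - a (Suc i) \<in> screeners K"
    proof (rule screenerI[where p = 2])
      show "a i - a (Suc i) \<in> K"
        using basis_in[OF i] basis_in[OF i'] by (simp add: lattice_basis group_closure.diff)
      show "(a i - a (Suc i)) \<bullet> (a i - a (Suc i)) = 2 * of_int 2"
        using i i' by (simp add: inner_diff_left inner_diff_right frame)
      fix y assume "y \<in> K"
      then obtain x :: "nat \<Rightarrow> int" where x: "y = (\<Sum>i<n. of_int (x i) *\<^sub>R a i)"
        using lattice_coords by blast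
      have "y \<bullet> (a i - a (Suc i)) = 2 * of_int (x i) - 2 * of_int (x (Suc i))"
        unfolding x inner_commute[of _ "a i - a (Suc i)"] inner_diff_left frame_inner[OF i] frame_inner[OF i'] ..
      then show "\<exists>k. y \<bullet> (a i - a (Suc i)) = of_int (2 * k)"
        by (intro exI[of _ "x i - x (Suc i)"]) simp
    qed simp_all
    then show ?thesis using False by (simp add: simple_root_def)
  qed
  have "root_base (screeners K) n (simple_root 1)"
    by (rule root_base_simple_root) (use simple sq in simp_all)
  then show ?thesis
    unfolding root_system_of_type_def
    using root_system_screeners cartan_simple_root_B by auto
qed

section \<open>Type \<open>D\<^sub>n\<close>\<close>

text \<open>The instances that matter are \<open>s = 1\<close> and \<open>s = - 1\<close>; the case
  \<open>i = j\<close> with \<open>s = 1\<close> is included and provides the doubled frame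
  vectors.\<close>

lemma frame_pair:
  fixes e :: "nat \<Rightarrow> 'a::real_vector"
  assumes "i < n" "j < n" "odd s"
  shows "e i + of_int s *\<^sub>R e j \<in> {\<Sum>i<n. of_int (x i) *\<^sub>R e i | x :: nat \<Rightarrow> int. even (\<Sum>i<n. x i)}"
proof -
  define x where "x l = (if l = i then 1 else 0) + (if l = j then s else 0)" for l :: nat
  have "(\<Sum>l<n. x l) = 1 + s" using assms by (simp add: x_def sum.distrib)
  moreover have "(\<Sum>l<n. of_int (x l) *\<^sub>R e l)
      = (\<Sum>l<n. (if l = i then e l else 0) + (if l = j then of_int s *\<^sub>R e l else 0))"
    by (intro sum.cong) (auto simp: x_def algebra_simps)
  then have "(\<Sum>l<n. of_int (x l) *\<^sub>R e l) = e i + of_int s *\<^sub>R e j"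
    using assms by (simp add: sum.distrib)
  ultimately show ?thesis using assms(3) by (intro CollectI exI[of _ x]) auto
qed

text \<open>If the simple roots of D_n are written as \<open>e i - e (i + 1)\<close> and finally
  \<open>e (n - 2) + e (n - 1)\<close>, half the difference of the last two is the last frame
  vector, and adding the chain from its end gives the others. The case n = 3 is allowed for the sake
  of A_3.\<close>

lemma D_frame:
  assumes "norm2_basis n (cartan_entry (TypeD n)) b K" and n: "n \<ge> 3"
  obtains e where "\<And>i j. i < n \<Longrightarrow> j < n \<Longrightarrow> e i \<bullet> e j = (if i = j then 1 else 0)"
    "K = {\<Sum>i<n. of_int (x i) *\<^sub>R e i | x :: nat \<Rightarrow> int. even (\<Sum>i<n. x i)}"
proof -
  interpret norm2_basis n "cartan_entry (TypeD n)" b K by fact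
  obtain N where N: "n = Suc (Suc N)" "N \<ge> 1"
    using n by (metis Suc_le_D Suc_le_mono numeral_3_eq_3 One_nat_def)
  let ?M = "Suc N"
  have G: "b i \<bullet> b j = (if i = j then 2 else if Suc i = j \<or> Suc j = i then - 1 else 0)"
    if "i < ?M" "j < ?M" for i j
    using gram[of i j] that N by (auto simp: cartan_entry_def)
  have GM: "b ?M \<bullet> b j = (if Suc j = N then - 1 else 0)" if "j < ?M" for j
    using gram[of ?M j] that N by (auto simp: cartan_entry_def)
  have GMM: "b ?M \<bullet> b ?M = 2" using gram[of ?M ?M] N by (simp add: cartan_entry_def)
  define h where "h = (1/2) *\<^sub>R (b ?M - b N)"
  have hb: "h \<bullet> b j = (if j = N then - 1 else 0)" if "j < ?M" for j
    using that by (auto simp: h_def inner_diff_left GM G)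
  have hh: "h \<bullet> h = 1"
    by (simp add: h_def inner_diff_left inner_diff_right GM G GMM inner_commute[of "b N" "b ?M"])
  define e where "e i = h + (\<Sum>j\<in>{i..<?M}. b j)" for i
  have eM: "e ?M = h" by (simp add: e_def)
  have eS: "e i = b i + e (Suc i)" if "i < ?M" for i
    unfolding e_def sum.atLeast_Suc_lessThan[OF that] by simp
  \<comment> \<open>All inner products are computed downwards from \<open>?M\<close> along
    \<open>e i = b i + e (Suc i)\<close>. Among the generators with index below \<open>i\<close>,
    only the neighbour \<open>b (i - 1)\<close> is not orthogonal to \<open>e i\<close>.\<close>
  have eb: "\<forall>j<i. e i \<bullet> b j = (if Suc j = i then - 1 else 0)" if "i \<le> ?M" for i
    using that
  proof (induction rule: inc_induct)
    case base
    then show ?case by (simp add: eM hb)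
  next
    case (step i)
    then show ?case by (auto simp: eS[of i] inner_add_left G)
  qed
  have ee: "e i \<bullet> e i = 1" if "i \<le> ?M" for i
    using that
  proof (induction rule: inc_induct)
    case base
    then show ?case by (simp add: eM hh)
  next
    case (step i)
    have "e (Suc i) \<bullet> b i = - 1" using eb[of "Suc i"] step by simp
    moreover from this have "b i \<bullet> e (Suc i) = - 1" by (metis inner_commute)
    ultimately show ?case
      using step by (simp add: eS[of i] inner_add_left inner_add_right G)
  qed
  have be: "b j \<bullet> e i = (if Suc j = i then - 1 else 0)" if "j < i" "i \<le> ?M" for i j
    using eb[OF that(2)] that(1) by (metis inner_commute)
  have e0: "e i \<bullet> e (Suc l) = 0" if "i \<le> l" "l < ?M" for i l
    using that(1)
  proof (induction rule: inc_induct)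
    case base
    then show ?case
      using be[of l "Suc l"] ee[of "Suc l"] that(2) by (simp add: eS[of l] inner_add_left)
  next
    case (step i)
    then show ?case
      using be[of i "Suc l"] that(2) by (simp add: eS[of i] inner_add_left)
  qed
  have on: "e i \<bullet> e j = (if i = j then 1 else 0)" if "i < n" "j < n" for i j
  proof -
    consider "i = j" | l where "j = Suc l" "i \<le> l" | l where "i = Suc l" "j \<le> l"
      by (metis less_eq_Suc_le linorder_cases Suc_le_D Suc_le_mono)
    then show ?thesis
      using that N ee[of i] e0[of i] e0[of j] inner_commute[of "e i" "e j"] by cases simp_all
  qed
  let ?T = "{\<Sum>i<n. of_int (x i) *\<^sub>R e i | x :: nat \<Rightarrow> int. even (\<Sum>i<n. x i)}"
  have bT: "b i \<in> ?T" if "i < n" for i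
  proof (cases "i < ?M")
    case True
    then have "b i = e i + of_int (- 1) *\<^sub>R e (Suc i)" using eS[of i] by simp
    then show ?thesis using frame_pair[of i n "Suc i" "- 1" e] True N by (simp only:) simp
  next
    case False
    then have "i = ?M" using that N by simp
    moreover have "2 *\<^sub>R h = b ?M - b N" by (simp add: h_def)
    then have "b ?M = e N + e ?M" using eS[of N] by (simp add: eM scaleR_2 algebra_simps)
    then have "b ?M = e N + of_int 1 *\<^sub>R e ?M" by simp
    ultimately show ?thesis using frame_pair[of N n ?M 1 e] N by (simp only:) simp
  qed
  have "x \<in> ?T" if "x \<in> K" for x
    using that unfolding lattice_basis
  proof induction
    case (base s)
    moreover have "0 \<in> ?T" by (intro CollectI exI[of _ "\<lambda>_. 0"]) simp
    ultimately show ?case using bT by auto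
  next
    case (diff s t)
    then obtain x y :: "nat \<Rightarrow> int" where "s = (\<Sum>i<n. of_int (x i) *\<^sub>R e i)" "even (\<Sum>i<n. x i)"
      "t = (\<Sum>i<n. of_int (y i) *\<^sub>R e i)" "even (\<Sum>i<n. y i)" by blast
    then show ?case
      by (intro CollectI exI[of _ "\<lambda>i. x i - y i"]) (simp add: sum_subtractf algebra_simps)
  qed
  moreover have "x \<in> K" if "x \<in> ?T" for x
  proof -
    from that obtain y :: "nat \<Rightarrow> int"
      where y: "x = (\<Sum>i<n. of_int (y i) *\<^sub>R e i)" "even (\<Sum>i<n. y i)" by blast
    obtain z where z: "(\<Sum>i<n. y i) = 2 * z" using y(2) by blast
    have diff: "e i - e ?M \<in> K" if "i \<le> ?M" for i
      using that
    proof (induction rule: inc_induct)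
      case base
      then show ?case by (simp add: lattice_basis)
    next
      case (step i)
      then have "b i + (e (Suc i) - e ?M) \<in> K"
        using basis_in[of i] N unfolding lattice_basis by (intro group_closure_add) auto
      then show ?case using step by (simp add: eS[of i] algebra_simps)
    qed
    have "2 *\<^sub>R e ?M = b ?M - b N" by (simp add: eM h_def)
    then have double: "2 *\<^sub>R e ?M \<in> K"
      using basis_in[of ?M] basis_in[of N] N by (simp add: lattice_basis group_closure.diff)
    \<comment> \<open>Moving all coordinates to the last place leaves the coordinate sum times
      \<open>e ?M\<close>. That sum is even, and twice \<open>e ?M\<close> is a difference of two
      generators.\<close>
    have "(\<Sum>i<n. of_int (y i) *\<^sub>R (e i - e ?M))
        = x - of_int (\<Sum>i<n. y i) *\<^sub>R e ?M"
      by (simp add: y(1) scaleR_diff_right sum_subtractf scaleR_sum_left)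
    then have "x = (\<Sum>i<n. of_int (y i) *\<^sub>R (e i - e ?M)) + of_int z *\<^sub>R (2 *\<^sub>R e ?M)"
      by (simp add: z)
    moreover have "(\<Sum>i<n. of_int (y i) *\<^sub>R (e i - e ?M)) \<in> K"
      using diff N unfolding lattice_basis
      by (intro group_closure_sum_mem group_closure_scaleR_of_int) auto
    moreover have "of_int z *\<^sub>R (2 *\<^sub>R e ?M) \<in> K"
      using double unfolding lattice_basis by (rule group_closure_scaleR_of_int)
    ultimately show ?thesis by (simp only: lattice_basis group_closure_add)
  qed
  ultimately have "K = ?T" by blast
  then show ?thesis using that on by blast
qed

lemma sum_squares_eq_1:
  fixes z :: "nat \<Rightarrow> int"
  assumes "(\<Sum>i<n. (z i)\<^sup>2) = 1"
  obtains i where "i < n" "z i = 1 \<or> z i = - 1" "\<And>j. j < n \<Longrightarrow> j \<noteq> i \<Longrightarrow> z j = 0"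
proof -
  have "\<exists>i<n. z i \<noteq> 0"
  proof (rule ccontr)
    assume "\<not> ?thesis"
    then have "(\<Sum>i<n. (z i)\<^sup>2) = 0" by simp
    then show False using assms by simp
  qed
  then obtain i where i: "i < n" "z i \<noteq> 0" by blast
  have split: "(\<Sum>i<n. (z i)\<^sup>2) = (z i)\<^sup>2 + (\<Sum>j\<in>{..<n} - {i}. (z j)\<^sup>2)"
    using i(1) by (intro sum.remove) auto
  have "(\<Sum>j\<in>{..<n} - {i}. (z j)\<^sup>2) \<ge> 0" by (intro sum_nonneg) auto
  moreover have "(z i)\<^sup>2 \<ge> 1" using i(2) by (simp add: int_one_le_iff_zero_less)
  ultimately have "(z i)\<^sup>2 = 1" "(\<Sum>j\<in>{..<n} - {i}. (z j)\<^sup>2) = 0" using split assms by linarith+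
  then have "z i = 1 \<or> z i = - 1" "\<forall>j\<in>{..<n} - {i}. z j = 0"
    by (auto simp: power2_eq_1_iff sum_nonneg_eq_0_iff)
  then show ?thesis using that[of i] i(1) by auto
qed

text \<open>From here on D_n enters only through its frame coordinates, so the same facts serve D_n
  for n > 4, D_4 and A_3 = D_3.\<close>

locale D_lattice = norm2_lattice S K + orthogonal_frame n 1 e
  for S K :: "'a::real_inner set" and n :: nat and e :: "nat \<Rightarrow> 'a" +
  assumes rank3: "n \<ge> 3"
    and coords: "K = {\<Sum>i<n. of_int (x i) *\<^sub>R e i | x :: nat \<Rightarrow> int. even (\<Sum>i<n. x i)}"
begin

definition vec :: "(nat \<Rightarrow> int) \<Rightarrow> 'a" where
  "vec x = (\<Sum>i<n. of_int (x i) *\<^sub>R e i)"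

lemma vec_inner: "vec x \<bullet> vec y = of_int (\<Sum>i<n. x i * y i)"
  unfolding vec_def by (simp add: frame_inner_sum)

lemma vec_norm: "vec x \<bullet> vec x = of_int (\<Sum>i<n. (x i)\<^sup>2)"
  by (simp add: vec_inner power2_eq_square)

lemma frame_inner_vec: "j < n \<Longrightarrow> e j \<bullet> vec x = of_int (x j)"
  unfolding vec_def by (simp add: frame_inner)

lemma vec_eq_imp: "vec x = vec y \<Longrightarrow> i < n \<Longrightarrow> x i = y i"
  by (metis frame_inner_vec of_int_eq_iff)

lemma vec_in_iff: "vec x \<in> K \<longleftrightarrow> even (\<Sum>i<n. x i)"
proof
  assume "vec x \<in> K"
  then obtain y where y: "vec x = vec y" "even (\<Sum>i<n. y i)"
    unfolding coords vec_def by blast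
  have "(\<Sum>i<n. x i) = (\<Sum>i<n. y i)" using vec_eq_imp[OF y(1)] by (intro sum.cong) auto
  then show "even (\<Sum>i<n. x i)" using y(2) by simp
qed (auto simp: coords vec_def)

lemma vecE: "v \<in> K \<Longrightarrow> (\<And>x. v = vec x \<Longrightarrow> even (\<Sum>i<n. x i) \<Longrightarrow> thesis) \<Longrightarrow> thesis"
  unfolding coords vec_def by blast

lemma pair_in: "i < n \<Longrightarrow> j < n \<Longrightarrow> odd s \<Longrightarrow> e i + of_int s *\<^sub>R e j \<in> K"
  unfolding coords by (rule frame_pair)

text \<open>Pairing with the vectors of \<open>pair_in\<close> shows that p divides
  \<open>x i + s * x j\<close>. For p = 3 the choice \<open>i = j\<close> makes all coordinates
  divisible by 3, so 9 would divide the square sum 6. For p = 2 it says that all coordinates have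
  the same parity.\<close>

lemma nonroot_screener_vec:
  assumes "vec x \<in> screeners K - roots K"
  shows "(\<Sum>i<n. (x i)\<^sup>2) = 4" "\<And>i. i < n \<Longrightarrow> even (x i - x 0)" "even (\<Sum>i<n. x i)"
proof -
  from assms obtain p :: int where p: "p \<in> {2, 3}" "vec x \<bullet> vec x = 2 * of_int p"
    and dvd: "\<And>y. y \<in> K \<Longrightarrow> \<exists>k::int. y \<bullet> vec x = of_int (p * k)"
    by (rule nonroot_screenerE) blast
  have "vec x \<in> K" using assms screenersD(1) by blast
  then show "even (\<Sum>i<n. x i)" by (simp add: vec_in_iff)
  have norm: "(\<Sum>i<n. (x i)\<^sup>2) = 2 * p"
  proof -
    have "real_of_int (\<Sum>i<n. (x i)\<^sup>2) = of_int (2 * p)" using p(2) vec_norm[of x] by simp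
    then show ?thesis by (simp only: of_int_eq_iff)
  qed
  have dvd2: "p dvd x i + s * x j" if ij: "i < n" "j < n" and s: "odd s" for i j s
  proof -
    obtain k :: int where "(e i + of_int s *\<^sub>R e j) \<bullet> vec x = of_int (p * k)"
      using dvd[OF pair_in[OF ij s]] by blast
    then have "real_of_int (x i + s * x j) = of_int (p * k)"
      using ij by (simp add: inner_add_left frame_inner_vec)
    then show ?thesis by (simp only: of_int_eq_iff dvd_triv_left)
  qed
  have "p = 2"
  proof (rule ccontr)
    assume "p \<noteq> 2"
    then have p3: "p = 3" using p(1) by simp
    have "9 dvd (x i)\<^sup>2" if "i < n" for i
    proof -
      have "3 dvd x i" using dvd2[OF that that, of 1] unfolding p3 by presburger
      then show ?thesis by (auto simp: power2_eq_square elim!: dvdE)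
    qed
    then have "9 dvd (\<Sum>i<n. (x i)\<^sup>2)" by (intro dvd_sum) auto
    then show False using norm p3 by simp
  qed
  then show "(\<Sum>i<n. (x i)\<^sup>2) = 4" using norm by simp
  show "even (x i - x 0)" if "i < n" for i
    using dvd2[OF that, of 0 "- 1"] rank3 \<open>p = 2\<close> by simp
qed

lemma vec_nonroot_screener:
  assumes "(\<Sum>i<n. (x i)\<^sup>2) = 4" "\<And>i. i < n \<Longrightarrow> even (x i - x 0)" "even (\<Sum>i<n. x i)"
  shows "vec x \<in> screeners K - roots K"
proof
  have norm: "vec x \<bullet> vec x = 4" using assms(1) vec_norm[of x] by simp
  show "vec x \<in> screeners K"
  proof (rule screenerI[where p = 2])
    show "vec x \<in> K" using assms(3) by (simp add: vec_in_iff)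
    show "vec x \<bullet> vec x = 2 * of_int 2" using norm by simp
    fix v assume "v \<in> K"
    then obtain y where y: "v = vec y" "even (\<Sum>i<n. y i)" by (rule vecE)
    \<comment> \<open>Comparing \<open>x i\<close> with \<open>x 0\<close> splits the inner product
      into two even parts: the differences are even, and so is the coordinate sum of
      \<open>y\<close>.\<close>
    have "(\<Sum>i<n. y i * x i) = (\<Sum>i<n. y i * (x i - x 0) + y i * x 0)"
      by (rule sum.cong) (simp_all only: ring_distribs diff_add_cancel)
    also have "\<dots> = (\<Sum>i<n. y i * (x i - x 0)) + (\<Sum>i<n. y i) * x 0"
      by (simp only: sum.distrib sum_distrib_right)
    finally have "(\<Sum>i<n. y i * x i) = (\<Sum>i<n. y i * (x i - x 0)) + (\<Sum>i<n. y i) * x 0" .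
    moreover have "even (\<Sum>i<n. y i * (x i - x 0))"
      by (intro dvd_sum dvd_mult assms(2)) simp
    ultimately have "even (\<Sum>i<n. y i * x i)" using y(2) by simp
    then obtain k where "(\<Sum>i<n. y i * x i) = 2 * k" by blast
    then have "v \<bullet> vec x = of_int (2 * k)" unfolding y(1) vec_inner by simp
    then show "\<exists>k::int. v \<bullet> vec x = of_int (2 * k)" by blast
  qed simp_all
  show "vec x \<notin> roots K" using norm by (simp add: roots_def)
qed

definition coord_long :: "'a set" where
  "coord_long = (\<lambda>(i, s). of_int (2 * s) *\<^sub>R e i) ` ({..<n} \<times> {1, - 1 :: int})"

text \<open>Twice the spin weights. Their norm is n, which is the norm 4 of the other long vectors
  only for n = 4; there the coordinate sum is even for every choice of signs, so both half-spin
  classes occur. Extensional functions make \<open>vec\<close> injective on the sign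
  patterns.\<close>

definition spin_long :: "'a set" where
  "spin_long = vec ` ({..<n} \<rightarrow>\<^sub>E {1, - 1})"

lemma vec_single: "i < n \<Longrightarrow> vec (\<lambda>j. if j = i then a else 0) = of_int a *\<^sub>R e i"
proof -
  assume i: "i < n"
  have "vec (\<lambda>j. if j = i then a else 0) = (\<Sum>j<n. if j = i then of_int a *\<^sub>R e j else 0)"
    unfolding vec_def by (intro sum.cong) auto
  then show ?thesis using i by simp
qed

lemma coord_long_subset: "coord_long \<subseteq> screeners K - roots K"
proof
  fix v assume "v \<in> coord_long"
  then obtain i s where si: "i < n" "s = 1 \<or> s = -1" "v = of_int (2 * s) *\<^sub>R e i"
    by (auto simp: coord_long_def)
  have "vec (\<lambda>j. if j = i then 2 * s else 0) \<in> screeners K - roots K"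
  proof (rule vec_nonroot_screener)
    have "(\<Sum>j<n. (if j = i then 2 * s else 0)\<^sup>2) = (\<Sum>j<n. if j = i then 4 else 0)"
      using si(2) by (intro sum.cong) auto
    then show "(\<Sum>j<n. (if j = i then 2 * s else 0)\<^sup>2) = 4" using si(1) by simp
  qed (use si in auto)
  then show "v \<in> screeners K - roots K" using vec_single[OF si(1)] si(3) by simp
qed

lemma spin_long_subset:
  assumes "n = 4"
  shows "spin_long \<subseteq> screeners K - roots K"
proof
  fix v assume "v \<in> spin_long"
  then obtain x where x: "x \<in> {..<n} \<rightarrow>\<^sub>E {1, - 1}" "v = vec x" by (auto simp: spin_long_def)
  have pm: "x i = 1 \<or> x i = - 1" if "i < n" for i using x(1) that by auto
  have "vec x \<in> screeners K - roots K"
  proof (rule vec_nonroot_screener)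
    have "(\<Sum>i<n. (x i)\<^sup>2) = (\<Sum>i<n. 1)" using pm by (intro sum.cong) (force simp: power2_eq_1_iff)+
    then show "(\<Sum>i<n. (x i)\<^sup>2) = 4" using assms by simp
    show "even (x i - x 0)" if "i < n" for i using pm[OF that] pm[of 0] rank3 by auto
    show "even (\<Sum>i<n. x i)"
      using pm[of 0] pm[of 1] pm[of 2] pm[of 3] assms by (auto simp: lessThan_nat_numeral)
  qed
  then show "v \<in> screeners K - roots K" using x(2) by simp
qed

lemma nonroot_screeners_cases:
  assumes v: "v \<in> screeners K - roots K"
  shows "v \<in> coord_long \<or> n = 4 \<and> v \<in> spin_long"
proof -
  have "v \<in> K" using v screenersD(1) by blast
  then obtain x where x: "v = vec x" by (rule vecE)
  have norm: "(\<Sum>i<n. (x i)\<^sup>2) = 4" and par: "\<And>i. i < n \<Longrightarrow> even (x i - x 0)"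
    and ev: "even (\<Sum>i<n. x i)"
    using nonroot_screener_vec[of x] v unfolding x by blast+
  show ?thesis
  proof (cases "even (x 0)")
    case True
    define z where "z i = x i div 2" for i
    have z: "x i = 2 * z i" if "i < n" for i
      using par[OF that] True by (simp add: z_def)
    have "4 * (\<Sum>i<n. (z i)\<^sup>2) = (\<Sum>i<n. (x i)\<^sup>2)"
      unfolding sum_distrib_left using z by (intro sum.cong) (auto simp: power_mult_distrib)
    then have "(\<Sum>i<n. (z i)\<^sup>2) = 1" using norm by simp
    then obtain i where i: "i < n" "z i = 1 \<or> z i = - 1" "\<And>j. j < n \<Longrightarrow> j \<noteq> i \<Longrightarrow> z j = 0"
      by (rule sum_squares_eq_1) blast
    have "vec x = vec (\<lambda>j. if j = i then 2 * z i else 0)"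
      unfolding vec_def using z i(3) by (intro sum.cong) auto
    then have "v = of_int (2 * z i) *\<^sub>R e i" using vec_single[OF i(1)] x by simp
    then show ?thesis using i(1,2) unfolding coord_long_def by force
  next
    case False
    have odd: "odd (x i)" if "i < n" for i using par[OF that] False by simp
    have ge1: "(x i)\<^sup>2 - 1 \<ge> 0" if "i < n" for i
      using odd[OF that] by (auto simp: int_one_le_iff_zero_less)
    then have nonneg: "(\<Sum>i<n. (x i)\<^sup>2 - 1) \<ge> 0" by (intro sum_nonneg) auto
    have sum1: "(\<Sum>i<n. (x i)\<^sup>2 - 1) = 4 - int n" using norm by (simp add: sum_subtractf)
    \<comment> \<open>Odd coordinates of square sum 4 force n \<le> 4, and their even sum forces n
      to be even; with n \<ge> 3 only n = 4 remains.\<close>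
    have "even (\<Sum>i<n. x i - 1)" using odd by (intro dvd_sum) auto
    then have "even n" using ev by (simp add: sum_subtractf)
    then have n4: "n = 4" using nonneg sum1 rank3 by presburger
    then have "\<forall>i\<in>{..<n}. (x i)\<^sup>2 - 1 = 0"
      using sum1 ge1 by (subst sum_nonneg_eq_0_iff[symmetric]) auto
    then have pm: "x i = 1 \<or> x i = - 1" if "i < n" for i using that by (simp add: power2_eq_1_iff)
    have "vec x = vec (restrict x {..<n})" unfolding vec_def by (intro sum.cong) auto
    moreover have "restrict x {..<n} \<in> {..<n} \<rightarrow>\<^sub>E {1, - 1}" using pm by auto
    ultimately show ?thesis using n4 x unfolding spin_long_def by blast
  qed
qed

lemma card_coord_long: "card coord_long = 2 * n"
proof -
  let ?f = "\<lambda>(i, s). of_int (2 * s) *\<^sub>R e i"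
  have key: "i = j \<and> s = t"
    if ij: "i < n" "j < n" and st: "s \<in> {1, - 1 :: int}" "t \<in> {1, - 1 :: int}"
      and eq: "of_int (2 * s) *\<^sub>R e i = of_int (2 * t) *\<^sub>R e j" for i j s t
  proof -
    have "e i \<bullet> (of_int (2 * s) *\<^sub>R e i) = e i \<bullet> (of_int (2 * t) *\<^sub>R e j)" using eq by simp
    then have "2 * s = (if i = j then 2 * t else 0)" using ij by (auto simp: frame)
    then show "i = j \<and> s = t" using st by (auto split: if_splits)
  qed
  have "inj_on ?f ({..<n} \<times> {1, - 1 :: int})"
  proof (rule inj_onI)
    fix a b :: "nat \<times> int"
    assume a: "a \<in> {..<n} \<times> {1, - 1}" and b: "b \<in> {..<n} \<times> {1, - 1}" and eq: "?f a = ?f b"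
    have "fst a = fst b \<and> snd a = snd b"
    proof (rule key)
      show "of_int (2 * snd a) *\<^sub>R e (fst a) = of_int (2 * snd b) *\<^sub>R e (fst b)"
        using eq by (simp only: case_prod_beta)
    qed (use a b in auto)
    then show "a = b" by (simp add: prod_eq_iff)
  qed
  then show ?thesis unfolding coord_long_def by (simp add: card_image card_cartesian_product)
qed

lemma card_spin_long: "card spin_long = 2 ^ n"
proof -
  have "inj_on vec ({..<n} \<rightarrow>\<^sub>E {1, - 1})"
    by (intro inj_onI PiE_ext[of _ "{..<n}"]) (auto dest: vec_eq_imp)
  then show ?thesis unfolding spin_long_def by (simp add: card_image card_PiE numeral_2_eq_2)
qed

lemma coord_spin_disjoint: "coord_long \<inter> spin_long = {}"
proof (rule ccontr)
  assume "coord_long \<inter> spin_long \<noteq> {}"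
  then obtain i s x where si: "i < n" "of_int (2 * s) *\<^sub>R e i = vec x"
    and x: "x \<in> {..<n} \<rightarrow>\<^sub>E {1, - 1}"
    unfolding coord_long_def spin_long_def by auto
  have "of_int (x i) = e i \<bullet> (of_int (2 * s) *\<^sub>R e i)" using si by (simp add: frame_inner_vec)
  then have "real_of_int (x i) = of_int (2 * s)" using si(1) by (simp add: frame)
  then have "x i = 2 * s" by linarith
  moreover have "x i = 1 \<or> x i = - 1" using x si(1) by auto
  ultimately show False by presburger
qed

lemma root_vecE:
  assumes "v \<in> roots K"
  obtains x where "v = vec x" "(\<Sum>i<n. (x i)\<^sup>2) = 2" "even (\<Sum>i<n. x i)"
proof -
  have "v \<in> K" using assms by (simp add: roots_def)
  then obtain x where x: "v = vec x" "even (\<Sum>i<n. x i)" by (rule vecE)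
  have "real_of_int (\<Sum>i<n. (x i)\<^sup>2) = of_int 2"
    using assms x(1) vec_norm[of x] by (simp add: roots_def)
  then have "(\<Sum>i<n. (x i)\<^sup>2) = 2" by (simp only: of_int_eq_iff)
  then show ?thesis using that x by blast
qed

lemma difference_root: "i < n \<Longrightarrow> j < n \<Longrightarrow> i \<noteq> j \<Longrightarrow> e i - e j \<in> screeners K"
  using pair_in[of i j "- 1"] roots_subset_screeners
  by (auto simp: roots_def inner_diff_left inner_diff_right frame)

text \<open>For n other than 4 the screeners of norm 4 are the doubled frame vectors up to sign.
  They are the long roots and the roots of D_n the short ones, so twice the last frame vector
  completes the differences to a base of type C.\<close>

lemma type_C:
  assumes "n \<noteq> 4"
  shows "roots K \<subseteq> screeners K \<and> card (screeners K - roots K) = 2 * n \<and>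
    root_system_of_type (TypeC n) (span K) (roots K \<union> (screeners K - roots K))"
proof (intro conjI)
  show "roots K \<subseteq> screeners K" by (rule roots_subset_screeners)
  have long: "screeners K - roots K = coord_long"
    using coord_long_subset nonroot_screeners_cases assms by blast
  then show "card (screeners K - roots K) = 2 * n" by (simp add: card_coord_long)
  have "root_base (screeners K) n (simple_root 2)"
  proof (rule root_base_simple_root)
    fix i assume i: "i < n"
    have "of_int 2 *\<^sub>R e i \<in> coord_long"
      unfolding coord_long_def using i by (intro image_eqI[of _ _ "(i, 1)"]) auto
    then have "of_int 2 *\<^sub>R e i \<in> screeners K" using coord_long_subset by blast
    then show "simple_root 2 i \<in> screeners K"
      using difference_root[of i "Suc i"] i by (simp add: simple_root_def)
  next
    fix a assume a: "a \<in> screeners K"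
    show "\<exists>x::nat \<Rightarrow> int. a = (\<Sum>i<n. of_int (x i) *\<^sub>R e i) \<and> (\<Sum>i<n. \<bar>x i\<bar>) \<le> 2 \<and>
      2 dvd (\<Sum>i<n. x i)"
    proof (cases "a \<in> roots K")
      case True
      then obtain x where "a = vec x" "(\<Sum>i<n. (x i)\<^sup>2) = 2" "even (\<Sum>i<n. x i)"
        by (rule root_vecE)
      then show ?thesis
        using sum_abs_le_sum_squares[of x "{..<n}"] by (intro exI[of _ x]) (simp add: vec_def)
    next
      case False
      then have "a \<in> coord_long" using a long by blast
      then obtain i s where si: "i < n" "s = 1 \<or> s = -1" "a = of_int (2 * s) *\<^sub>R e i"
        by (auto simp: coord_long_def)
      let ?x = "\<lambda>j. if j = i then 2 * s else 0"
      have "(\<Sum>j<n. \<bar>?x j\<bar>) = (\<Sum>j<n. if j = i then 2 else 0)"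
        using si(2) by (intro sum.cong) auto
      then have "(\<Sum>j<n. \<bar>?x j\<bar>) \<le> 2" by simp
      moreover have "a = (\<Sum>j<n. of_int (?x j) *\<^sub>R e j)"
        using vec_single[OF si(1)] si(3) unfolding vec_def by metis
      moreover have "2 dvd (\<Sum>j<n. ?x j)" by (intro dvd_sum) auto
      ultimately show ?thesis by (intro exI[of _ ?x] conjI)
    qed
  qed simp
  moreover have "roots K \<union> (screeners K - roots K) = screeners K"
    using roots_subset_screeners by blast
  ultimately show "root_system_of_type (TypeC n) (span K) (roots K \<union> (screeners K - roots K))"
    unfolding root_system_of_type_def
    using root_system_screeners cartan_simple_root_C by auto
qed

end

section \<open>The exceptional case D_4\<close>

text \<open>
  The four linear forms are the coordinates with respect to the base
  \<open>e\<^sub>0 - e\<^sub>1 - e\<^sub>2 - e\<^sub>3, 2e\<^sub>3, e\<^sub>2 - e\<^sub>3, e\<^sub>1 - e\<^sub>2\<close> of \<open>F\<^sub>4\<close>, the second one doubled.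
\<close>
lemma F4_coords_same_sign:
  fixes a b c d :: int
  assumes "a\<^sup>2 + b\<^sup>2 + c\<^sup>2 + d\<^sup>2 = 2 \<or>
      a\<^sup>2 + b\<^sup>2 + c\<^sup>2 + d\<^sup>2 = 4 \<and> even (b - a) \<and> even (c - a) \<and> even (d - a)"
  shows "a \<ge> 0 \<and> 3 * a + b + c + d \<ge> 0 \<and> 2 * a + b + c \<ge> 0 \<and> a + b \<ge> 0 \<or>
    a \<le> 0 \<and> 3 * a + b + c + d \<le> 0 \<and> 2 * a + b + c \<le> 0 \<and> a + b \<le> 0"
proof -
  have finite_check: "\<forall>a\<in>{-2, -1, 0, 1, 2::int}. \<forall>b\<in>{-2, -1, 0, 1, 2}. \<forall>c\<in>{-2, -1, 0, 1, 2}.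
    \<forall>d\<in>{-2, -1, 0, 1, 2}.
      a * a + b * b + c * c + d * d = 2 \<or>
      a * a + b * b + c * c + d * d = 4 \<and> even (b - a) \<and> even (c - a) \<and> even (d - a) \<longrightarrow>
      a \<ge> 0 \<and> 3 * a + b + c + d \<ge> 0 \<and> 2 * a + b + c \<ge> 0 \<and> a + b \<ge> 0 \<or>
      a \<le> 0 \<and> 3 * a + b + c + d \<le> 0 \<and> 2 * a + b + c \<le> 0 \<and> a + b \<le> 0"
    by code_simp
  have small: "x \<in> {-2, -1, 0, 1, 2}" if "x\<^sup>2 \<le> 4" for x :: int
  proof -
    have "\<bar>x\<bar> \<le> 2" using that abs_le_square_iff[of x 2] by simp
    then show ?thesis by auto
  qed
  have "a\<^sup>2 \<ge> 0" "b\<^sup>2 \<ge> 0" "c\<^sup>2 \<ge> 0" "d\<^sup>2 \<ge> 0" by simp_all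
  then have "a\<^sup>2 \<le> 4" "b\<^sup>2 \<le> 4" "c\<^sup>2 \<le> 4" "d\<^sup>2 \<le> 4" using assms by linarith+
  then show ?thesis
    using finite_check[rule_format, OF small small small small] assms
    unfolding power2_eq_square by blast
qed

text \<open>The 24 = 8 + 16 long roots are those along the frame and those with all coordinates 1 or
  -1. The base consists of one of each kind and two differences, with the long simple roots first as
  in the numbering of the F_4 diagram.\<close>

lemma (in D_lattice) type_F4:
  assumes n4: "n = 4"
  shows "roots K \<subseteq> screeners K \<and> card (screeners K - roots K) = 24 \<and>
    root_system_of_type TypeF4 (span K) (roots K \<union> (screeners K - roots K))"
proof (intro conjI)
  show "roots K \<subseteq> screeners K" by (rule roots_subset_screeners)
  have "screeners K - roots K = coord_long \<union> spin_long"
    using coord_long_subset spin_long_subset nonroot_screeners_cases n4 by blast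
  moreover have "finite coord_long" "finite spin_long"
    by (auto simp: coord_long_def spin_long_def intro!: finite_PiE)
  moreover have "card coord_long = 8" using card_coord_long n4 by simp
  moreover have "card spin_long = 16" using card_spin_long n4 by simp
  ultimately show "card (screeners K - roots K) = 24"
    using coord_spin_disjoint by (simp add: card_Un_disjoint)
  have fr: "e i \<bullet> e j = (if i = j then 1 else 0)" if "i < 4" "j < 4" for i j
    using frame that n4 by simp
  define f where "f = (!) [e 0 - e 1 - e 2 - e 3, 2 *\<^sub>R e 3, e 2 - e 3, e 1 - e 2]"
  \<comment> \<open>Dual to \<open>f\<close> up to scale: the nonzero pairings are 1, 2, 1, 1. So
    the pairings of a vector with \<open>d\<close> are its coefficients in the base, except that the
    second must be halved.\<close>
  define d where "d = (!) [e 0, 3 *\<^sub>R e 0 + e 1 + e 2 + e 3, 2 *\<^sub>R e 0 + e 1 + e 2, e 0 + e 1]"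
  have lt4: "i \<in> {0, 1, 2, 3}" if "i < 4" for i :: nat using that by auto
  have f: "f 0 = e 0 - e 1 - e 2 - e 3" "f 1 = 2 *\<^sub>R e 3" "f 2 = e 2 - e 3" "f 3 = e 1 - e 2"
    by (simp_all add: f_def)
  have d: "d 0 = e 0" "d 1 = 3 *\<^sub>R e 0 + e 1 + e 2 + e 3" "d 2 = 2 *\<^sub>R e 0 + e 1 + e 2"
    "d 3 = e 0 + e 1"
    by (simp_all add: d_def)
  have vec4: "vec x = of_int (x 0) *\<^sub>R e 0 + of_int (x 1) *\<^sub>R e 1 + of_int (x 2) *\<^sub>R e 2 + of_int (x 3) *\<^sub>R e 3" for x
    unfolding vec_def by (simp add: n4 lessThan_nat_numeral)
  have "root_base (screeners K) 4 f"
  proof (rule root_baseI)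
    show "d k \<bullet> f i = 0 \<longleftrightarrow> i \<noteq> k" if "i < 4" "k < 4" for i k
      using lt4[OF that(1)] lt4[OF that(2)]
      by (elim insertE emptyE; simp add: f d[unfolded One_nat_def] f[unfolded One_nat_def] d fr
          inner_add_left inner_diff_left inner_add_right inner_diff_right)
    have "vec (\<lambda>i. if i = 0 then 1 else - 1) \<in> screeners K - roots K"
      by (rule vec_nonroot_screener) (auto simp: n4 lessThan_nat_numeral)
    then have "f 0 \<in> screeners K" by (simp add: vec4 f)
    moreover have "of_int (2 * 1) *\<^sub>R e 3 \<in> coord_long"
      unfolding coord_long_def using n4 by (intro image_eqI[of _ _ "(3, 1)"]) auto
    then have "f 1 \<in> screeners K" using coord_long_subset unfolding f by auto
    moreover have "f 2 \<in> screeners K" "f 3 \<in> screeners K"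
      unfolding f using n4 by (auto intro!: difference_root)
    ultimately show "f i \<in> screeners K" if "i < 4" for i
      using lt4[OF that] by auto
    fix a assume a: "a \<in> screeners K"
    then have "a \<in> K" by (rule screenersD(1))
    then obtain x where x: "a = vec x" "even (\<Sum>i<n. x i)" by (rule vecE)
    have "(\<Sum>i<n. (x i)\<^sup>2) = 2 \<or>
        (\<Sum>i<n. (x i)\<^sup>2) = 4 \<and> even (x 1 - x 0) \<and> even (x 2 - x 0) \<and> even (x 3 - x 0)"
    proof (cases "a \<in> roots K")
      case True
      then obtain y where y: "a = vec y" "(\<Sum>i<n. (y i)\<^sup>2) = 2" by (rule root_vecE)
      have "(\<Sum>i<n. (x i)\<^sup>2) = (\<Sum>i<n. (y i)\<^sup>2)"
        using vec_eq_imp[of x y] x(1) y(1) by (intro sum.cong) auto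
      then show ?thesis using y(2) by simp
    next
      case False
      then have v: "vec x \<in> screeners K - roots K" using a x(1) by simp
      have "even (x 1 - x 0)" "even (x 2 - x 0)" "even (x 3 - x 0)"
        by (rule nonroot_screener_vec(2)[OF v]; simp add: n4)+
      then show ?thesis using nonroot_screener_vec(1)[OF v] by blast
    qed
    moreover have "(\<Sum>i<n. (x i)\<^sup>2) = (x 0)\<^sup>2 + (x 1)\<^sup>2 + (x 2)\<^sup>2 + (x 3)\<^sup>2"
      by (simp add: n4 lessThan_nat_numeral)
    ultimately have "(x 0)\<^sup>2 + (x 1)\<^sup>2 + (x 2)\<^sup>2 + (x 3)\<^sup>2 = 2 \<or>
        (x 0)\<^sup>2 + (x 1)\<^sup>2 + (x 2)\<^sup>2 + (x 3)\<^sup>2 = 4 \<and>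
        even (x 1 - x 0) \<and> even (x 2 - x 0) \<and> even (x 3 - x 0)"
      by simp
    note sgn = F4_coords_same_sign[OF this]
    have "(\<Sum>i<n. x i) = x 0 + x 1 + x 2 + x 3" by (simp add: n4 lessThan_nat_numeral)
    then have "even (x 0 + x 1 + x 2 + x 3)" using x(2) by (simp only:)
    \<comment> \<open>This differs from the even coordinate sum by \<open>2 * x 0\<close>; half of
      it is the second coefficient.\<close>
    then have "even (3 * x 0 + x 1 + x 2 + x 3)" by presburger
    then obtain h where h: "3 * x 0 + x 1 + x 2 + x 3 = 2 * h" by blast
    define c where "c = (!) [x 0, h, 2 * x 0 + x 1 + x 2, x 0 + x 1]"
    have c: "c 0 = x 0" "c 1 = h" "c 2 = 2 * x 0 + x 1 + x 2" "c 3 = x 0 + x 1"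
      by (simp_all add: c_def)
    have scaleR_3: "3 *\<^sub>R v = v + (v + v)" for v :: 'a
      using scaleR_add_left[of 1 2 v] by (simp add: scaleR_2)
    have x3: "x 3 = 2 * h - 3 * x 0 - x 1 - x 2" using h by simp
    have "a = of_int (c 0) *\<^sub>R f 0 + of_int (c 1) *\<^sub>R f 1 + of_int (c 2) *\<^sub>R f 2 + of_int (c 3) *\<^sub>R f 3"
      unfolding x(1) vec4 c f x3 
      by (simp add: algebra_simps)
        (simp add: mult.commute[of _ 2] mult.commute[of _ 3] scaleR_2 scaleR_3 flip: scaleR_scaleR)
    also have "\<dots> = (\<Sum>i<4. of_int (c i) *\<^sub>R f i)" by (simp add: lessThan_nat_numeral)
    finally have "a = (\<Sum>i<4. of_int (c i) *\<^sub>R f i)" .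
    moreover have "(c 0 \<ge> 0 \<and> c 1 \<ge> 0 \<and> c 2 \<ge> 0 \<and> c 3 \<ge> 0) \<or>
        (c 0 \<le> 0 \<and> c 1 \<le> 0 \<and> c 2 \<le> 0 \<and> c 3 \<le> 0)"
      using sgn unfolding c h by auto
    then have "(\<forall>i<4. c i \<ge> 0) \<or> (\<forall>i<4. c i \<le> 0)"
      using lt4 by (metis insertE singletonD)
    ultimately show "\<exists>c::nat \<Rightarrow> int. a = (\<Sum>i<4. of_int (c i) *\<^sub>R f i) \<and>
        ((\<forall>i<4. c i \<ge> 0) \<or> (\<forall>i<4. c i \<le> 0))" by blast
  qed
  moreover have "2 * (f i \<bullet> f j) / (f j \<bullet> f j) = of_int (cartan_entry TypeF4 i j)"
    if "i < 4" "j < 4" for i j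
    using lt4[OF that(1)] lt4[OF that(2)]
    by (elim insertE emptyE; simp add: f f[unfolded One_nat_def] fr cartan_entry_def
          inner_add_left inner_diff_left inner_add_right inner_diff_right)
  moreover have "roots K \<union> (screeners K - roots K) = screeners K"
    using roots_subset_screeners by blast
  ultimately show "root_system_of_type TypeF4 (span K) (roots K \<union> (screeners K - roots K))"
    unfolding root_system_of_type_def using root_system_screeners by auto
qed

section \<open>Passage from the diagrams D_n and A_3 to the frame model\<close>

lemma D_basis_screeners:
  assumes basis: "norm2_basis n (cartan_entry (TypeD n)) b K" and n: "n \<ge> 3"
  obtains S e where "D_lattice S K n e"
proof -
  interpret norm2_basis n "cartan_entry (TypeD n)" b K by fact
  obtain e where e: "\<And>i j. i < n \<Longrightarrow> j < n \<Longrightarrow> e i \<bullet> e j = (if i = j then 1 else 0)"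
    "K = {\<Sum>i<n. of_int (x i) *\<^sub>R e i | x :: nat \<Rightarrow> int. even (\<Sum>i<n. x i)}"
    using D_frame[OF basis n] by blast
  have "D_lattice (b ` {..<n}) K n e"
    using e n by unfold_locales auto
  then show ?thesis by (rule that)
qed

lemma screeners_D:
  assumes "root_lattice_of_type (TypeD n) K" "n > 4"
  shows "roots K \<subseteq> screeners K \<and> card (screeners K - roots K) = 2 * n \<and>
    root_system_of_type (TypeC n) (span K) (roots K \<union> (screeners K - roots K))"
proof -
  obtain b where "norm2_basis (dynkin_rank (TypeD n)) (cartan_entry (TypeD n)) b K"
    using assms(1) by (rule root_lattice_of_typeE)
  then obtain S e where "D_lattice S K n e"
    using D_basis_screeners[of n b K] assms(2) by auto
  then show ?thesis using D_lattice.type_C assms(2) by blast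
qed

lemma screeners_D4:
  assumes "root_lattice_of_type (TypeD 4) K"
  shows "roots K \<subseteq> screeners K \<and> card (screeners K - roots K) = 24 \<and>
    root_system_of_type TypeF4 (span K) (roots K \<union> (screeners K - roots K))"
proof -
  obtain b where "norm2_basis (dynkin_rank (TypeD 4)) (cartan_entry (TypeD 4)) b K"
    using assms(1) by (rule root_lattice_of_typeE)
  then obtain S e where "D_lattice S K 4 e"
    using D_basis_screeners[of 4 b K] by auto
  then show ?thesis using D_lattice.type_F4 by blast
qed

lemma screeners_A3:
  assumes "root_lattice_of_type (TypeA 3) K"
  shows "roots K \<subseteq> screeners K \<and> card (screeners K - roots K) = 6 \<and>
    root_system_of_type (TypeC 3) (span K) (roots K \<union> (screeners K - roots K))"
proof -
  obtain b where "norm2_basis (dynkin_rank (TypeA 3)) (cartan_entry (TypeA 3)) b K"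
    using assms(1) by (rule root_lattice_of_typeE)
  then interpret norm2_basis 3 "cartan_entry (TypeA 3)" b K by simp
  (* exchanging the first two nodes turns the diagram A_3 into D_3 *)
  define b' where "b' = (!) [b 1, b 0, b 2]"
  have lt3: "i \<in> {0, 1, 2}" if "i < 3" for i :: nat using that by auto
  have three: "{..<3} = {0, 1, 2 :: nat}" by auto
  have "norm2_basis 3 (cartan_entry (TypeD 3)) b' K"
  proof
    show "K = group_closure (b' ` {..<3})"
      using lattice_basis unfolding three by (simp add: b'_def insert_commute)
    show "b' i \<bullet> b' j = of_int (cartan_entry (TypeD 3) i j)" if "i < 3" "j < 3" for i j
      using lt3[OF that(1)] lt3[OF that(2)]
      by (elim insertE emptyE; simp add: b'_def gram cartan_entry_def)
    show "cartan_entry (TypeD 3) i i = 2" for i by (simp add: cartan_entry_def)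
  qed
  then obtain S e where "D_lattice S K 3 e"
    using D_basis_screeners[of 3 b' K] by auto
  then show ?thesis using D_lattice.type_C[of S K 3 e] by simp
qed

section \<open>Type \<open>A\<^sub>2\<close>\<close>

text \<open>The form is the norm of \<open>k - l * omega\<close> in the Eisenstein integers, omega a
  primitive cube root of unity, and the list is that of the six units. Completing the square bounds
  each variable by 1 in absolute value.\<close>

lemma eisenstein_units:
  fixes k l :: int
  assumes "k * k + k * l + l * l = 1"
  shows "(k, l) \<in> {(1, 0), (-1, 0), (0, 1), (0, -1), (1, -1), (-1, 1)}"
proof -
  have *: "y \<in> {-1, 0, 1}" if "x * x + x * y + y * y = 1" for x y :: int
  proof -
    have "(2 * x + y)\<^sup>2 + 3 * y\<^sup>2 = 4 * (x * x + x * y + y * y)"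
      by (simp add: power2_eq_square algebra_simps)
    also have "\<dots> = 4" using that by simp
    finally have "3 * y\<^sup>2 \<le> 4" using zero_le_power2[of "2 * x + y"] by linarith
    then have "y\<^sup>2 \<le> 1\<^sup>2" by simp
    then have "\<bar>y\<bar> \<le> 1" using abs_le_square_iff[of y 1] by simp
    then show ?thesis by auto
  qed
  have "l \<in> {-1, 0, 1}" "k \<in> {-1, 0, 1}"
    using *[of k l] *[of l k] assms by (auto simp: algebra_simps)
  then show ?thesis using assms by auto
qed

text \<open>The determinant 3 of the Cartan matrix excludes p = 2. For p = 3 the screeners are three
  times the dual vectors of norm 2/3, which in dual coordinates are the units of
  \<open>eisenstein_units\<close>.\<close>

lemma screeners_A2:
  assumes "root_lattice_of_type (TypeA 2) K"
  shows "roots K \<subseteq> screeners K \<and> card (screeners K - roots K) = 6 \<and>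
    root_system_of_type TypeG2 (span K) (roots K \<union> (screeners K - roots K))"
proof (intro conjI)
  obtain b where "norm2_basis (dynkin_rank (TypeA 2)) (cartan_entry (TypeA 2)) b K"
    using assms(1) by (rule root_lattice_of_typeE)
  then interpret norm2_basis 2 "cartan_entry (TypeA 2)" b K by simp
  let ?C = "cartan_entry (TypeA 2)"
  have C: "?C 0 0 = 2" "?C 0 (Suc 0) = - 1" "?C (Suc 0) 0 = - 1" "?C (Suc 0) (Suc 0) = 2"
    by (simp_all add: cartan_entry_def)
  have two: "{..<2} = {0, Suc 0}" by auto
  have ab: "b 0 \<bullet> b 0 = 2" "b 0 \<bullet> b (Suc 0) = - 1" "b (Suc 0) \<bullet> b 0 = - 1" "b (Suc 0) \<bullet> b (Suc 0) = 2"
    using gram[of 0 0] gram[of 0 "Suc 0"] gram[of "Suc 0" 0] gram[of "Suc 0" "Suc 0"] C by auto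
  define w where "w c d = of_int c *\<^sub>R b 0 + of_int d *\<^sub>R b (Suc 0)" for c d :: int
  have w_in: "w c d \<in> K" for c d
    unfolding w_def lattice_basis
    by (intro group_closure_add group_closure_scaleR_of_int) (auto intro: group_closure.base)
  have wE: "\<exists>c d. v = w c d" if "v \<in> K" for v
    using that unfolding lattice_coords by (auto simp: w_def two)
  have w_inner: "w c d \<bullet> w c' d' = of_int (c * (2 * c' - d') + d * (2 * d' - c'))" for c d c' d'
    by (simp add: w_def inner_add_left inner_add_right ab algebra_simps)
  define U :: "(int \<times> int) set" where "U = {(1, 0), (-1, 0), (0, 1), (0, -1), (1, -1), (-1, 1)}"
  \<comment> \<open>Three times the dual vector whose inner products with the generators are
    \<open>k\<close> and \<open>l\<close>; the coefficients form three times the inverse Cartan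
    matrix.\<close>
  define h where "h = (\<lambda>(k, l). w (2 * k + l) (k + 2 * l))"
  have hE: "\<exists>k l. (k, l) \<in> U \<and> x = w (2 * k + l) (k + 2 * l)" if "x \<in> h ` U" for x
    using that by (auto simp: h_def)
  show "roots K \<subseteq> screeners K" by (rule roots_subset_screeners)
  have long: "screeners K - roots K = h ` U"
  proof (intro equalityI subsetI)
    fix x assume "x \<in> screeners K - roots K"
    then obtain p c k where p: "p \<in> {2, 3}" and x: "x = (\<Sum>i<2. of_int (c i) *\<^sub>R b i)"
      and k: "\<And>j. j < 2 \<Longrightarrow> (\<Sum>i<2. c i * ?C i j) = p * k j"
      and norm: "(\<Sum>j<2. c j * k j) = 2" and ndvd: "\<not> (\<forall>i<2. p dvd c i)"
      by (rule nonroot_screener_coords) blast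
    have k0: "2 * c 0 - c (Suc 0) = p * k 0" and k1: "2 * c (Suc 0) - c 0 = p * k (Suc 0)"
      using k[of 0] k[of "Suc 0"] by (simp_all add: two C)
    have "p = 3"
    proof (rule ccontr)
      assume "p \<noteq> 3"
      then have p2: "p = 2" using p by simp
      have "p dvd c 0" "p dvd c (Suc 0)" using k0 k1 unfolding p2 by presburger+
      then show False using ndvd by (auto simp: less_2_cases_iff)
    qed
    then have c: "c 0 = 2 * k 0 + k (Suc 0)" "c (Suc 0) = k 0 + 2 * k (Suc 0)"
      using k0 k1 by simp_all
    have "k 0 * k 0 + k 0 * k (Suc 0) + k (Suc 0) * k (Suc 0) = 1"
      using norm by (simp add: two c algebra_simps)
    then have "(k 0, k (Suc 0)) \<in> U" unfolding U_def by (rule eisenstein_units)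
    moreover have "x = h (k 0, k (Suc 0))" by (simp add: h_def x two w_def c)
    ultimately show "x \<in> h ` U" by blast
  next
    fix x assume "x \<in> h ` U"
    then obtain k l where kl: "(k, l) \<in> U" and x: "x = w (2 * k + l) (k + 2 * l)" using hE by blast
    have norm: "x \<bullet> x = 6" using kl by (auto simp: U_def x w_inner)
    have "x \<in> screeners K"
    proof (rule screenerI[where p = 3])
      show "x \<in> K" using w_in x by simp
      show "x \<bullet> x = 2 * of_int 3" using norm by simp
      fix y assume "y \<in> K"
      then obtain c d where y: "y = w c d" using wE by blast
      show "\<exists>j::int. y \<bullet> x = of_int (3 * j)"
        by (intro exI[of _ "c * k + d * l"]) (simp add: x y w_inner algebra_simps)
    qed simp_all
    then show "x \<in> screeners K - roots K" using norm by (simp add: roots_def)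
  qed
  have h_eq: "k = k' \<and> l = l'" if eq: "w (2 * k + l) (k + 2 * l) = w (2 * k' + l') (k' + 2 * l')"
    for k l k' l'
  proof -
    have "w 1 0 \<bullet> w (2 * k + l) (k + 2 * l) = of_int (3 * k)"
      "w 1 0 \<bullet> w (2 * k' + l') (k' + 2 * l') = of_int (3 * k')"
      "w 0 1 \<bullet> w (2 * k + l) (k + 2 * l) = of_int (3 * l)"
      "w 0 1 \<bullet> w (2 * k' + l') (k' + 2 * l') = of_int (3 * l')"
      by (simp_all add: w_inner)
    then have "real_of_int (3 * k) = of_int (3 * k')" "real_of_int (3 * l) = of_int (3 * l')"
      using eq by simp_all
    then show ?thesis by simp
  qed
  have "inj_on h U" by (rule inj_onI) (use h_eq in \<open>auto simp: h_def\<close>)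
  then show "card (screeners K - roots K) = 6" unfolding long by (simp add: card_image U_def)
  \<comment> \<open>Roots of norms 2 and 6 with inner product -3, the long one last as in the
    numbering of the G_2 diagram. In this base \<open>w c d\<close> has the coefficients
    \<open>c + d\<close> and \<open>d\<close>.\<close>
  define g where "g = (!) [w 1 0, w (- 1) 1]"
  define d where "d = (!) [w 1 1, w 1 2]"
  have lt2: "i \<in> {0, 1}" if "i < 2" for i :: nat using that by auto
  have "root_base (screeners K) 2 g"
  proof (rule root_baseI)
    show "d k \<bullet> g i = 0 \<longleftrightarrow> i \<noteq> k" if "i < 2" "k < 2" for i k
      using lt2[OF that(1)] lt2[OF that(2)] by (auto simp: g_def d_def w_inner)
    have "w 1 0 \<in> roots K" using w_in by (simp add: roots_def w_inner)
    moreover have "w (- 1) 1 \<in> h ` U" by (intro image_eqI[of _ _ "(-1, 1)"]) (auto simp: h_def U_def)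
    ultimately show "g i \<in> screeners K" if "i < 2" for i
      using lt2[OF that] roots_subset_screeners long by (auto simp: g_def)
    fix a assume a: "a \<in> screeners K"
    have "\<exists>c d. a = w c d \<and> (c + d \<ge> 0 \<and> d \<ge> 0 \<or> c + d \<le> 0 \<and> d \<le> 0)"
    proof (cases "a \<in> roots K")
      case True
      then have "a \<in> K" by (simp add: roots_def)
      then obtain c d where cd: "a = w c d" using wE by blast
      then have "real_of_int (c * (2 * c - d) + d * (2 * d - c)) = of_int 2"
        using True w_inner[of c d c d] by (simp add: roots_def)
      then have "c * (2 * c - d) + d * (2 * d - c) = 2" by (simp only: of_int_eq_iff)
      \<comment> \<open>Changing the sign of \<open>d\<close> turns the norm form of A_2 into the
        form of \<open>eisenstein_units\<close>.\<close>
      then have "c * c + c * (- d) + (- d) * (- d) = 1" by (simp add: algebra_simps)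
      from eisenstein_units[OF this] show ?thesis
        using cd by (intro exI[of _ c] exI[of _ d]) auto
    next
      case False
      then have "a \<in> h ` U" using a long by blast
      then obtain k l where kl: "(k, l) \<in> U" and x: "a = w (2 * k + l) (k + 2 * l)" using hE by blast
      show ?thesis
        using kl by (intro exI[of _ "2 * k + l"] exI[of _ "k + 2 * l"]) (auto simp: U_def x)
    qed
    then obtain c d where cd: "a = w c d" "c + d \<ge> 0 \<and> d \<ge> 0 \<or> c + d \<le> 0 \<and> d \<le> 0" by blast
    define m where "m = (!) [c + d, d]"
    have "a = (\<Sum>i<2. of_int (m i) *\<^sub>R g i)"
      by (simp add: two cd(1) m_def g_def w_def algebra_simps)
    moreover have "(\<forall>i<2. m i \<ge> 0) \<or> (\<forall>i<2. m i \<le> 0)"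
      using cd(2) by (auto simp: m_def less_2_cases_iff)
    ultimately show "\<exists>c::nat \<Rightarrow> int. a = (\<Sum>i<2. of_int (c i) *\<^sub>R g i) \<and>
        ((\<forall>i<2. c i \<ge> 0) \<or> (\<forall>i<2. c i \<le> 0))" by blast
  qed
  moreover have "2 * (g i \<bullet> g j) / (g j \<bullet> g j) = of_int (cartan_entry TypeG2 i j)"
    if "i < 2" "j < 2" for i j
  proof -
    have "g 0 \<bullet> g 0 = 2" "g 0 \<bullet> g 1 = - 3" "g 1 \<bullet> g 0 = - 3" "g 1 \<bullet> g 1 = 6"
      by (simp_all add: g_def w_inner)
    then show ?thesis
      using lt2[OF that(1)] lt2[OF that(2)] by (auto simp: cartan_entry_def)
  qed
  moreover have "roots K \<union> (screeners K - roots K) = screeners K"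
    using roots_subset_screeners by blast
  ultimately show "root_system_of_type TypeG2 (span K) (roots K \<union> (screeners K - roots K))"
    unfolding root_system_of_type_def using root_system_screeners by auto
qed

theorem theorem1p3:
  shows
    "(\<forall>L :: 'a::real_inner set. even_lattice L \<and> L = group_closure (screeners L) \<longrightarrow>
        (\<exists>m p K. (\<forall>i<m. p i > 0 \<and> simply_laced_root_lattice (K i)) \<and>
           orthogonal_direct_sum L m (\<lambda>i. sqrt_scaled (p i) (K i))))
     \<and> (\<forall>n (K :: 'b::real_inner set).
          (n > 3 \<and> root_lattice_of_type (TypeA n) K \<or>
           n \<in> {6, 7, 8} \<and> root_lattice_of_type (TypeE n) K) \<longrightarrow>
          screeners K = roots K)
     \<and> (\<forall>K :: 'b set. root_lattice_of_type (TypeA 2) K \<longrightarrow>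
          roots K \<subseteq> screeners K \<and> card (screeners K - roots K) = 6 \<and>
          root_system_of_type TypeG2 (span K) (roots K \<union> (screeners K - roots K)))
     \<and> (\<forall>K :: 'b set. root_lattice_of_type (TypeA 3) K \<longrightarrow>
          roots K \<subseteq> screeners K \<and> card (screeners K - roots K) = 6 \<and>
          root_system_of_type (TypeC 3) (span K) (roots K \<union> (screeners K - roots K)))
     \<and> (\<forall>K :: 'b set. root_lattice_of_type (TypeD 4) K \<longrightarrow>
          roots K \<subseteq> screeners K \<and> card (screeners K - roots K) = 24 \<and>
          root_system_of_type TypeF4 (span K) (roots K \<union> (screeners K - roots K)))
     \<and> (\<forall>n (K :: 'b set). n > 4 \<and> root_lattice_of_type (TypeD n) K \<longrightarrow>
          roots K \<subseteq> screeners K \<and> card (screeners K - roots K) = 2 * n \<and>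
          root_system_of_type (TypeC n) (span K) (roots K \<union> (screeners K - roots K)))
     \<and> (\<forall>n (K :: 'b set) M.
          n \<ge> 2 \<and> (\<forall>i<n. root_lattice_of_type (TypeA 1) (M i)) \<and> orthogonal_direct_sum K n M \<longrightarrow>
          root_system_of_type (TypeB n) (span K) (screeners K))"
proof (intro conjI allI impI)
  fix L :: "'a set" assume L: "even_lattice L \<and> L = group_closure (screeners L)"
  show "\<exists>m p K. (\<forall>i<m. p i > 0 \<and> simply_laced_root_lattice (K i)) \<and>
      orthogonal_direct_sum L m (\<lambda>i. sqrt_scaled (p i) (K i))"
    by (rule screener_lattice_decomposition) (use L in blast)+
next
  fix n and K :: "'b set"
  assume "n > 3 \<and> root_lattice_of_type (TypeA n) K \<or>
    n \<in> {6, 7, 8} \<and> root_lattice_of_type (TypeE n) K"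
  then consider "n > 3" "root_lattice_of_type (TypeA n) K" | "root_lattice_of_type (TypeE 6) K"
    | "root_lattice_of_type (TypeE 7) K" | "root_lattice_of_type (TypeE 8) K"
    by auto
  then show "screeners K = roots K"
    by cases (simp_all only: screeners_A screeners_E6 screeners_E7 screeners_E8)
next
  fix n and K :: "'b set"
  assume "n > 4 \<and> root_lattice_of_type (TypeD n) K"
  then have K: "root_lattice_of_type (TypeD n) K" "n > 4" by auto
  show "roots K \<subseteq> screeners K" "card (screeners K - roots K) = 2 * n"
    "root_system_of_type (TypeC n) (span K) (roots K \<union> (screeners K - roots K))"
    using screeners_D[OF K] by blast+
next
  fix n and K :: "'b set" and M
  assume "n \<ge> 2 \<and> (\<forall>i<n. root_lattice_of_type (TypeA 1) (M i)) \<and> orthogonal_direct_sum K n M"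
  then show "root_system_of_type (TypeB n) (span K) (screeners K)"
    by (intro screeners_sum_A1[of n M K]) simp_all
qed (simp_all only: screeners_A2 screeners_A3 screeners_D4)

end
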